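(* Let $C_\bullet$ be the bifiltered chain complex of a simplicial bifiltration $\mathcal K$, and let $G_i,R_i,S_i$, $p^1_i,p^2_i$, $f^0_i,f^1_i,f^2_i$, $h^0_i,h^1_i$, $H^0_i$ be the modules and maps of the log-path construction described in the context. Then the chain complex $$0\leftarrow G_0\leftarrow G_1\oplus R_0\leftarrow G_2\oplus R_1\oplus S_0\leftarrow G_3\oplus R_2\oplus S_1\leftarrow\cdots$$ whose degree-$i$ module is $G_i\oplus R_{i-1}\oplus S_{i-2}$ and whose boundary map $G_i\oplus R_{i-1}\oplus S_{i-2}\to G_{i-1}\oplus R_{i-2}\oplus S_{i-3}$ is $$\begin{pmatrix} f^0_i & p^1_{i-1} & 0\\ h^0_i & f^1_{i-1} & p^2_{i-2}\\ H^0_i & h^1_{i-1} & f^2_{i-2}\end{pmatrix}$$ (modules with negative index being $0$) is a free resolution of $C_\bullet$.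
   Context: All vector spaces are over $\mathbb Z_2$; $\mathbb N^2$ carries the product order and $x\vee y$ is the coordinatewise maximum. A simplicial bifiltration $\mathcal K$ is a finite abstract simplicial complex with subcomplexes $(\mathcal K_s)_{s\in\mathbb N^2}$ such that $\mathcal K_s\subseteq\mathcal K_t$ whenever $s\le t$ (every simplex lies in some $\mathcal K_s$). For a simplex $\sigma$, $\mathrm{supp}(\sigma)=\{s:\sigma\in\mathcal K_s\}$ is an upset, and $\mathcal G(\sigma)$ is its finite set of minimal elements. A bipersistence module is a functor from $\mathbb N^2$ to vector spaces. $U_A$ denotes the upset module of $A\subseteq\mathbb N^2$ ($\mathbb Z_2$ at grades $s$ above some $a\in A$, $0$ elsewhere, identity structure maps inside the upset). A module is free if it is a direct sum of modules $U_{\{x\}}$; a basis element of grade $x$ generates a summand $U_{\{x\}}$. $U_\sigma=U_{\mathcal G(\sigma)}$. $C_i=\bigoplus_{\dim\sigma=i}U_\sigma$ with simplicial boundary maps $\partial_i$. A free resolution of $C_\bullet$ is a chain complex $F_\bullet$ of free modules with a chain map $F_\bullet\to C_\bullet$ inducing isomorphisms on all homology modules. Log-path resolution of $\sigma$: let $\mathcal G(\sigma)=\{x_0,\dots,x_{N}\}$, ordered by first coordinate, $N=n_\sigma-1$. $G_\sigma$ has basis $g_\sigma^{x_0},\dots,g_\sigma^{x_N}$ (generators, $g^{x_j}_\sigma$ of grade $x_j$). $R_\sigma$ has one basis element (relation, thought of as an edge) for each pair $(j,\ell)=(s2^t,(s+1)2^t)$ with integers $s,t\ge0$ and $\ell\le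 N$, of grade $x_j\vee x_\ell$; $p^1_\sigma$ sends it to $g_\sigma^{x_j}+g_\sigma^{x_\ell}$. $S_\sigma$ has one basis element (syzygy, thought of as a triangle) for each triple $((s-1)2^t,s2^t,(s+1)2^t)$ with $s>0$ odd, $t\ge0$, $(s+1)2^t\le N$, of grade $x_{(s-1)2^t}\vee x_{(s+1)2^t}$; $p^2_\sigma$ sends it to the sum of the three relations that are the edges of the triangle. $\alpha_\sigma:G_\sigma\to U_\sigma$ is the canonical surjection. Set $G_i,R_i,S_i,p^1_i,p^2_i,\alpha_i$ to be the direct sums over all $i$-simplices $\sigma$. Then $0\leftarrow C_i\leftarrow G_i\leftarrow R_i\leftarrow S_i\leftarrow 0$ is exact. Paths: for two generators $g_\sigma^{x_j},g_\sigma^{x_\ell}$ of the same simplex with $j<\ell$, their connecting path is the sum of the relations forming the shortest monotone (index-increasing) path from $j$ to $\ell$ in the graph with vertex set $\{0,\dots,N\}$ whose edges are the pairs $(s2^t,(s+1)2^t)$ with integers $s,t\ge0$ and $(s+1)2^t\le N$, each edge corresponding to a relation in the basis of $R_\sigma$ (it is $0$ if $j=\ell$). $f^0_i:G_i\to G_{i-1}$ sends $g_\sigma^x$ to $\sum_\tau g_\tau^{y_\tau}$ over the facets $\tau$ of $\sigma$, where $y_\tau\in\mathcal G(\tau)$ is chosen with $y_\tau\le x$. $f^1_i:R_i\to R_{i-1}$ sends a relation of $\sigma$ with endpoints $g,g'$ to the sum, over the facets $\tau$ of $\sigma$, of the path connecting the $\tau$-components of $f^0_i(g)$ and $f^0_i(g')$.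 $h^0_i:G_i\to R_{i-2}$ sends $g_\sigma^x$ to the sum, over codimension-2 faces $\tau$ of $\sigma$, of the path connecting the two generators of $\tau$ contributing to $f^0_{i-1}f^0_i(g_\sigma^x)$. Thus $p^1_{i-1}f^1_i=f^0_ip^1_i$ and $p^1_{i-2}h^0_i=f^0_{i-1}f^0_i$. The maps $f^2_i:S_i\to S_{i-1}$, $h^1_i:R_i\to S_{i-2}$, $H^0_i:G_i\to S_{i-3}$ are the unique morphisms with $p^2_{i-1}f^2_i=f^1_ip^2_i$, $p^2_{i-2}h^1_i=h^0_ip^1_i+f^1_{i-1}f^1_i$, and $p^2_{i-3}H^0_i=h^0_{i-1}f^0_i+f^1_{i-2}h^0_i$. *)

theory Defs
  imports
    "HOL-Algebra.AbelCoset"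
    "HOL-Algebra.Module"
    "HOL-Library.Poly_Mapping"
    "HOL-Library.Product_Order"
    "HOL-Library.Z2"
begin

section \<open>Bipersistence modules\<close>

text \<open>Product_Order makes \<open>\<le>\<close> on pairs the product order and \<open>sup\<close> the coordinatewise maximum.\<close>

type_synonym grade = "nat \<times> nat"

definition Z2 :: "bit ring" where
  "Z2 = \<lparr>carrier = UNIV, mult = (*), one = 1, zero = 0, add = (+)\<rparr>"

text \<open>A vector space over \<open>Z2\<close> is a \<open>module Z2\<close>; the locale \<open>module\<close> puts no condition
  on the record fields \<open>mult\<close> and \<open>one\<close> of the module itself.\<close>

definition vector_space_of ::
  "'v set \<Rightarrow> 'v \<Rightarrow> ('v \<Rightarrow> 'v \<Rightarrow> 'v) \<Rightarrow> (bit \<Rightarrow> 'v \<Rightarrow> 'v) \<Rightarrow> (bit, 'v) module" where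
  "vector_space_of V z p m =
     \<lparr>carrier = V, mult = undefined, one = undefined, zero = z, add = p, smult = m\<rparr>"

definition linear_map :: "(bit, 'v) module \<Rightarrow> (bit, 'w) module \<Rightarrow> ('v \<Rightarrow> 'w) \<Rightarrow> bool" where
  "linear_map V W f \<longleftrightarrow>
     f \<in> carrier V \<rightarrow> carrier W \<and>
     (\<forall>x\<in>carrier V. \<forall>y\<in>carrier V. f (x \<oplus>\<^bsub>V\<^esub> y) = f x \<oplus>\<^bsub>W\<^esub> f y) \<and>
     (\<forall>c. \<forall>x\<in>carrier V. f (c \<odot>\<^bsub>V\<^esub> x) = c \<odot>\<^bsub>W\<^esub> f x)"

text \<open>Cosets of \<open>N\<close>, with addition and scaling induced by representatives.\<close>

definition quotient_space :: "(bit, 'v) module \<Rightarrow> 'v set \<Rightarrow> (bit, 'v set) module" where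
  "quotient_space V N =
     vector_space_of (a_rcosets\<^bsub>V\<^esub> N) N
       (\<lambda>A B. A <+>\<^bsub>V\<^esub> B)
       (\<lambda>c A. \<Union>x\<in>A. N +>\<^bsub>V\<^esub> (c \<odot>\<^bsub>V\<^esub> x))"

record 'v bimodule =
  at_grade :: "grade \<Rightarrow> (bit, 'v) module"
  shift :: "grade \<Rightarrow> grade \<Rightarrow> 'v \<Rightarrow> 'v"

definition bipersistence_module :: "'v bimodule \<Rightarrow> bool" where
  "bipersistence_module M \<longleftrightarrow>
     (\<forall>s. module Z2 (at_grade M s)) \<and>
     (\<forall>s t. s \<le> t \<longrightarrow> linear_map (at_grade M s) (at_grade M t) (shift M s t)) \<and>
     (\<forall>s. \<forall>v\<in>carrier (at_grade M s). shift M s s v = v) \<and>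
     (\<forall>r s t. r \<le> s \<longrightarrow> s \<le> t \<longrightarrow>
        (\<forall>v\<in>carrier (at_grade M r). shift M s t (shift M r s v) = shift M r t v))"

definition bimodule_hom ::
  "'v bimodule \<Rightarrow> 'w bimodule \<Rightarrow> (grade \<Rightarrow> 'v \<Rightarrow> 'w) \<Rightarrow> bool" where
  "bimodule_hom M N f \<longleftrightarrow>
     (\<forall>s. linear_map (at_grade M s) (at_grade N s) (f s)) \<and>
     (\<forall>s t. s \<le> t \<longrightarrow>
        (\<forall>v\<in>carrier (at_grade M s). f t (shift M s t v) = shift N s t (f s v)))"

definition bimodule_iso ::
  "'v bimodule \<Rightarrow> 'w bimodule \<Rightarrow> (grade \<Rightarrow> 'v \<Rightarrow> 'w) \<Rightarrow> bool" where
  "bimodule_iso M N f \<longleftrightarrow>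
     bimodule_hom M N f \<and>
     (\<forall>s. bij_betw (f s) (carrier (at_grade M s)) (carrier (at_grade N s)))"

text \<open>The structure map \<open>U\<^sub>s \<rightarrow> U\<^sub>t\<close> can be written as the identity throughout: if \<open>s\<close> is not
  in the upset, it is only applied to \<open>0\<close>.\<close>

definition upset_module :: "grade set \<Rightarrow> bit bimodule" where
  "upset_module A =
     \<lparr>at_grade = (\<lambda>s. vector_space_of {v. v \<noteq> 0 \<longrightarrow> (\<exists>a\<in>A. a \<le> s)} 0 (+) (*)),
      shift = (\<lambda>s t v. v)\<rparr>"

text \<open>The direct sum of the upset modules \<open>U\<^bsub>A b\<^esub>\<close> over \<open>b \<in> B\<close>.\<close>

definition upset_sum :: "'b set \<Rightarrow> ('b \<Rightarrow> grade set) \<Rightarrow> ('b \<Rightarrow>\<^sub>0 bit) bimodule" where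
  "upset_sum B A =
     \<lparr>at_grade = (\<lambda>s. vector_space_of
        {v. Poly_Mapping.keys v \<subseteq> B \<and>
            (\<forall>b\<in>B. Poly_Mapping.lookup v b \<in> carrier (at_grade (upset_module (A b)) s))}
        0 (+) (\<lambda>c. Poly_Mapping.map ((*) c))),
      shift = (\<lambda>s t v. v)\<rparr>"

definition free_on :: "'b set \<Rightarrow> ('b \<Rightarrow> grade) \<Rightarrow> ('b \<Rightarrow>\<^sub>0 bit) bimodule" where
  "free_on B gr = upset_sum B (\<lambda>b. {gr b})"

text \<open>Indexing the summands by elements of \<open>'v\<close> is no restriction: a basis of a free module
  with underlying type \<open>'v\<close> always injects into \<open>'v\<close>.\<close>

definition free_bimodule :: "'v bimodule \<Rightarrow> bool" where
  "free_bimodule M \<longleftrightarrow>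
     bipersistence_module M \<and> (\<exists>(B :: 'v set) gr f. bimodule_iso (free_on B gr) M f)"

definition bimodule_sum :: "'v bimodule \<Rightarrow> 'w bimodule \<Rightarrow> ('v \<times> 'w) bimodule" (infixr "\<oplus>\<^sub>m" 65) where
  "M \<oplus>\<^sub>m N =
     \<lparr>at_grade = (\<lambda>s. vector_space_of
        (carrier (at_grade M s) \<times> carrier (at_grade N s))
        (\<zero>\<^bsub>at_grade M s\<^esub>, \<zero>\<^bsub>at_grade N s\<^esub>)
        (\<lambda>(x, y) (x', y'). (x \<oplus>\<^bsub>at_grade M s\<^esub> x', y \<oplus>\<^bsub>at_grade N s\<^esub> y'))
        (\<lambda>c (x, y). (c \<odot>\<^bsub>at_grade M s\<^esub> x, c \<odot>\<^bsub>at_grade N s\<^esub> y))),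
      shift = (\<lambda>s t (x, y). (shift M s t x, shift N s t y))\<rparr>"


section \<open>Chain complexes and free resolutions\<close>

text \<open>Degrees range over all integers; \<open>bdry X i\<close> goes from degree \<open>i\<close> to degree \<open>i - 1\<close>.\<close>

record 'v bicomplex =
  chains :: "int \<Rightarrow> 'v bimodule"
  bdry :: "int \<Rightarrow> grade \<Rightarrow> 'v \<Rightarrow> 'v"

abbreviation chains_at :: "'v bicomplex \<Rightarrow> int \<Rightarrow> grade \<Rightarrow> (bit, 'v) module" where
  "chains_at X i s \<equiv> at_grade (chains X i) s"

definition chain_complex :: "'v bicomplex \<Rightarrow> bool" where
  "chain_complex X \<longleftrightarrow>
     (\<forall>i. bipersistence_module (chains X i)) \<and>
     (\<forall>i. bimodule_hom (chains X i) (chains X (i - 1)) (bdry X i)) \<and>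
     (\<forall>i s. \<forall>v\<in>carrier (chains_at X i s).
        bdry X (i - 1) s (bdry X i s v) = \<zero>\<^bsub>chains_at X (i - 2) s\<^esub>)"

definition cycles :: "'v bicomplex \<Rightarrow> int \<Rightarrow> grade \<Rightarrow> 'v set" where
  "cycles X i s =
     {v \<in> carrier (chains_at X i s). bdry X i s v = \<zero>\<^bsub>chains_at X (i - 1) s\<^esub>}"

definition boundaries :: "'v bicomplex \<Rightarrow> int \<Rightarrow> grade \<Rightarrow> 'v set" where
  "boundaries X i s = bdry X (i + 1) s ` carrier (chains_at X (i + 1) s)"

text \<open>The maps between homology modules are given by applying a map to representatives of a coset;
  the union is over equal cosets.\<close>

definition homology :: "'v bicomplex \<Rightarrow> int \<Rightarrow> 'v set bimodule" where
  "homology X i =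
     \<lparr>at_grade = (\<lambda>s. quotient_space ((chains_at X i s)\<lparr>carrier := cycles X i s\<rparr>) (boundaries X i s)),
      shift = (\<lambda>s t A. \<Union>v\<in>A. boundaries X i t +>\<^bsub>chains_at X i t\<^esub> shift (chains X i) s t v)\<rparr>"

definition homology_map ::
  "'w bicomplex \<Rightarrow> (int \<Rightarrow> grade \<Rightarrow> 'v \<Rightarrow> 'w) \<Rightarrow> int \<Rightarrow> grade \<Rightarrow> 'v set \<Rightarrow> 'w set" where
  "homology_map Y f i s A = (\<Union>v\<in>A. boundaries Y i s +>\<^bsub>chains_at Y i s\<^esub> f i s v)"

definition chain_map ::
  "'v bicomplex \<Rightarrow> 'w bicomplex \<Rightarrow> (int \<Rightarrow> grade \<Rightarrow> 'v \<Rightarrow> 'w) \<Rightarrow> bool" where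
  "chain_map X Y f \<longleftrightarrow>
     (\<forall>i. bimodule_hom (chains X i) (chains Y i) (f i)) \<and>
     (\<forall>i s. \<forall>v\<in>carrier (chains_at X i s). f (i - 1) s (bdry X i s v) = bdry Y i s (f i s v))"

definition free_resolution :: "'v bicomplex \<Rightarrow> 'w bicomplex \<Rightarrow> bool" where
  "free_resolution X C \<longleftrightarrow>
     chain_complex X \<and> (\<forall>i. free_bimodule (chains X i)) \<and>
     (\<exists>f. chain_map X C f \<and>
       (\<forall>i. bimodule_iso (homology X i) (homology C i) (homology_map C f i)))"


section \<open>Simplicial bifiltrations\<close>

definition simplicial_complex :: "'a set set \<Rightarrow> bool" where
  "simplicial_complex K \<longleftrightarrow>
     finite K \<and> (\<forall>\<sigma>\<in>K. finite \<sigma> \<and> \<sigma> \<noteq> {}) \<and>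
     (\<forall>\<sigma>\<in>K. \<forall>\<tau>. \<tau> \<subseteq> \<sigma> \<and> \<tau> \<noteq> {} \<longrightarrow> \<tau> \<in> K)"

definition simplicial_bifiltration :: "'a set set \<Rightarrow> (grade \<Rightarrow> 'a set set) \<Rightarrow> bool" where
  "simplicial_bifiltration K F \<longleftrightarrow>
     simplicial_complex K \<and>
     (\<forall>s. F s \<subseteq> K \<and> simplicial_complex (F s)) \<and>
     (\<forall>s t. s \<le> t \<longrightarrow> F s \<subseteq> F t) \<and>
     (\<forall>\<sigma>\<in>K. \<exists>s. \<sigma> \<in> F s)"

definition simplices :: "'a set set \<Rightarrow> int \<Rightarrow> 'a set set" where
  "simplices K i = {\<sigma> \<in> K. int (card \<sigma>) - 1 = i}"

definition faces :: "nat \<Rightarrow> 'a set \<Rightarrow> 'a set set" where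
  "faces codim \<sigma> = {\<tau>. \<tau> \<noteq> {} \<and> \<tau> \<subseteq> \<sigma> \<and> card \<tau> + codim = card \<sigma>}"

abbreviation facets :: "'a set \<Rightarrow> 'a set set" where
  "facets \<equiv> faces 1"

definition supp :: "(grade \<Rightarrow> 'a set set) \<Rightarrow> 'a set \<Rightarrow> grade set" where
  "supp F \<sigma> = {s. \<sigma> \<in> F s}"

definition min_grades :: "(grade \<Rightarrow> 'a set set) \<Rightarrow> 'a set \<Rightarrow> grade set" where
  "min_grades F \<sigma> = {s \<in> supp F \<sigma>. \<forall>t\<in>supp F \<sigma>. t \<le> s \<longrightarrow> t = s}"

text \<open>The linear extension of a map on basis elements; all coefficients of
  \<open>v\<close> on \<open>keys v\<close> are \<open>1\<close>.\<close>

definition basis_elem :: "'b \<Rightarrow> ('b \<Rightarrow>\<^sub>0 bit)" where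
  "basis_elem b = Poly_Mapping.single b 1"

definition lin_ext :: "('b \<Rightarrow> ('c \<Rightarrow>\<^sub>0 bit)) \<Rightarrow> ('b \<Rightarrow>\<^sub>0 bit) \<Rightarrow> ('c \<Rightarrow>\<^sub>0 bit)" where
  "lin_ext \<phi> v = (\<Sum>b\<in>Poly_Mapping.keys v. \<phi> b)"

definition simplicial_chains ::
  "'a set set \<Rightarrow> (grade \<Rightarrow> 'a set set) \<Rightarrow> ('a set \<Rightarrow>\<^sub>0 bit) bicomplex" where
  "simplicial_chains K F =
     \<lparr>chains = (\<lambda>i. upset_sum (simplices K i) (min_grades F)),
      bdry = (\<lambda>i s. lin_ext (\<lambda>\<sigma>. \<Sum>\<tau>\<in>facets \<sigma>. basis_elem \<tau>))\<rparr>"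


section \<open>Log-path resolutions\<close>

text \<open>Distinct minimal grades differ in the first coordinate, so sorting by it is unambiguous.\<close>

definition min_grade :: "(grade \<Rightarrow> 'a set set) \<Rightarrow> 'a set \<Rightarrow> nat \<Rightarrow> grade" where
  "min_grade F \<sigma> j = sorted_key_list_of_set fst (min_grades F \<sigma>) ! j"

definition last_index :: "(grade \<Rightarrow> 'a set set) \<Rightarrow> 'a set \<Rightarrow> nat" where
  "last_index F \<sigma> = card (min_grades F \<sigma>) - 1"

definition dyadic_edges :: "nat \<Rightarrow> (nat \<times> nat) set" where
  "dyadic_edges N = {(s * 2 ^ t, (s + 1) * 2 ^ t) | s t. (s + 1) * 2 ^ t \<le> N}"

definition dyadic_triangles :: "nat \<Rightarrow> (nat \<times> nat \<times> nat) set" where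
  "dyadic_triangles N =
     {((s - 1) * 2 ^ t, s * 2 ^ t, (s + 1) * 2 ^ t) | s t. 0 < s \<and> odd s \<and> (s + 1) * 2 ^ t \<le> N}"

text \<open>Basis elements are tagged with their simplex: \<open>(\<sigma>, j)\<close> is the generator of grade \<open>x\<^sub>j\<close>,
  \<open>(\<sigma>, (j, l))\<close> a relation and \<open>(\<sigma>, (j, k, l))\<close> a syzygy. In negative degrees there are no
  simplices and the modules vanish.\<close>

type_synonym 'a gen = "'a set \<times> nat"
type_synonym 'a rel = "'a set \<times> (nat \<times> nat)"
type_synonym 'a syz = "'a set \<times> (nat \<times> nat \<times> nat)"

definition Gmod :: "'a set set \<Rightarrow> (grade \<Rightarrow> 'a set set) \<Rightarrow> int \<Rightarrow> ('a gen \<Rightarrow>\<^sub>0 bit) bimodule" where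
  "Gmod K F i = free_on (SIGMA \<sigma>:simplices K i. {0..last_index F \<sigma>})
     (\<lambda>(\<sigma>, j). min_grade F \<sigma> j)"

definition Rmod :: "'a set set \<Rightarrow> (grade \<Rightarrow> 'a set set) \<Rightarrow> int \<Rightarrow> ('a rel \<Rightarrow>\<^sub>0 bit) bimodule" where
  "Rmod K F i = free_on (SIGMA \<sigma>:simplices K i. dyadic_edges (last_index F \<sigma>))
     (\<lambda>(\<sigma>, (j, l)). sup (min_grade F \<sigma> j) (min_grade F \<sigma> l))"

definition Smod :: "'a set set \<Rightarrow> (grade \<Rightarrow> 'a set set) \<Rightarrow> int \<Rightarrow> ('a syz \<Rightarrow>\<^sub>0 bit) bimodule" where
  "Smod K F i = free_on (SIGMA \<sigma>:simplices K i. dyadic_triangles (last_index F \<sigma>))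
     (\<lambda>(\<sigma>, (j, k, l)). sup (min_grade F \<sigma> j) (min_grade F \<sigma> l))"

text \<open>The maps below given on basis elements do not depend on the degree or the grade;
  \<open>p\<^sup>1\<^sub>i\<close>, \<open>f\<^sup>0\<^sub>i\<close>, etc. are their restrictions.\<close>

definition p1 :: "('a rel \<Rightarrow>\<^sub>0 bit) \<Rightarrow> ('a gen \<Rightarrow>\<^sub>0 bit)" where
  "p1 = lin_ext (\<lambda>(\<sigma>, (j, l)). basis_elem (\<sigma>, j) + basis_elem (\<sigma>, l))"

definition p2 :: "('a syz \<Rightarrow>\<^sub>0 bit) \<Rightarrow> ('a rel \<Rightarrow>\<^sub>0 bit)" where
  "p2 = lin_ext (\<lambda>(\<sigma>, (j, k, l)).
     basis_elem (\<sigma>, (j, k)) + basis_elem (\<sigma>, (k, l)) + basis_elem (\<sigma>, (j, l)))"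

definition monotone_path :: "nat \<Rightarrow> nat \<Rightarrow> nat \<Rightarrow> nat list \<Rightarrow> bool" where
  "monotone_path N j l xs \<longleftrightarrow>
     xs \<noteq> [] \<and> hd xs = j \<and> last xs = l \<and> set xs \<subseteq> {0..N} \<and>
     successively (\<lambda>a b. (a, b) \<in> dyadic_edges N) xs"

definition shortest_path :: "nat \<Rightarrow> nat \<Rightarrow> nat \<Rightarrow> nat list" where
  "shortest_path N j l = (ARG_MIN length xs. monotone_path N j l xs)"

text \<open>The indices \<open>j\<close> and \<open>l\<close> may be given in either order.\<close>

definition connecting_path ::
  "(grade \<Rightarrow> 'a set set) \<Rightarrow> 'a set \<Rightarrow> nat \<Rightarrow> nat \<Rightarrow> ('a rel \<Rightarrow>\<^sub>0 bit)" where
  "connecting_path F \<sigma> j l =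
     (let xs = shortest_path (last_index F \<sigma>) (min j l) (max j l)
      in \<Sum>e\<leftarrow>zip xs (tl xs). basis_elem (\<sigma>, e))"

text \<open>\<open>y \<sigma> j \<tau>\<close> is the index of the chosen minimal grade of the facet \<open>\<tau>\<close> below the \<open>j\<close>-th minimal
  grade of \<open>\<sigma>\<close>.\<close>

definition facet_choice ::
  "'a set set \<Rightarrow> (grade \<Rightarrow> 'a set set) \<Rightarrow> ('a set \<Rightarrow> nat \<Rightarrow> 'a set \<Rightarrow> nat) \<Rightarrow> bool" where
  "facet_choice K F y \<longleftrightarrow>
     (\<forall>\<sigma>\<in>K. \<forall>j\<le>last_index F \<sigma>. \<forall>\<tau>\<in>facets \<sigma>.
        y \<sigma> j \<tau> \<le> last_index F \<tau> \<and> min_grade F \<tau> (y \<sigma> j \<tau>) \<le> min_grade F \<sigma> j)"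

definition f0 ::
  "('a set \<Rightarrow> nat \<Rightarrow> 'a set \<Rightarrow> nat) \<Rightarrow> ('a gen \<Rightarrow>\<^sub>0 bit) \<Rightarrow> ('a gen \<Rightarrow>\<^sub>0 bit)" where
  "f0 y = lin_ext (\<lambda>(\<sigma>, j). \<Sum>\<tau>\<in>facets \<sigma>. basis_elem (\<tau>, y \<sigma> j \<tau>))"

definition f1 ::
  "(grade \<Rightarrow> 'a set set) \<Rightarrow> ('a set \<Rightarrow> nat \<Rightarrow> 'a set \<Rightarrow> nat) \<Rightarrow> ('a rel \<Rightarrow>\<^sub>0 bit) \<Rightarrow> ('a rel \<Rightarrow>\<^sub>0 bit)" where
  "f1 F y = lin_ext (\<lambda>(\<sigma>, (j, l)). \<Sum>\<tau>\<in>facets \<sigma>. connecting_path F \<tau> (y \<sigma> j \<tau>) (y \<sigma> l \<tau>))"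

text \<open>A codimension-2 face \<open>\<tau>\<close> of \<open>\<sigma>\<close> lies in exactly two facets \<open>\<rho>\<close> of \<open>\<sigma>\<close>, each of which
  contributes one generator of \<open>\<tau>\<close>; the two generators may coincide.\<close>

definition contributing :: "('a set \<Rightarrow> nat \<Rightarrow> 'a set \<Rightarrow> nat) \<Rightarrow> 'a set \<Rightarrow> nat \<Rightarrow> 'a set \<Rightarrow> nat set" where
  "contributing y \<sigma> j \<tau> = {y \<rho> (y \<sigma> j \<rho>) \<tau> | \<rho>. \<rho> \<in> facets \<sigma> \<and> \<tau> \<in> facets \<rho>}"

definition h0 ::
  "(grade \<Rightarrow> 'a set set) \<Rightarrow> ('a set \<Rightarrow> nat \<Rightarrow> 'a set \<Rightarrow> nat) \<Rightarrow> ('a gen \<Rightarrow>\<^sub>0 bit) \<Rightarrow> ('a rel \<Rightarrow>\<^sub>0 bit)" where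
  "h0 F y = lin_ext (\<lambda>(\<sigma>, j). \<Sum>\<tau>\<in>faces 2 \<sigma>.
     connecting_path F \<tau> (Min (contributing y \<sigma> j \<tau>)) (Max (contributing y \<sigma> j \<tau>)))"

text \<open>The following three morphisms are determined by the stated properties on the carriers, where
  \<open>p2\<close> is injective; their values elsewhere are irrelevant, and not unique, hence the use of
  \<open>SOME\<close> instead of \<open>THE\<close>.\<close>

definition f2 ::
  "'a set set \<Rightarrow> (grade \<Rightarrow> 'a set set) \<Rightarrow> ('a set \<Rightarrow> nat \<Rightarrow> 'a set \<Rightarrow> nat) \<Rightarrow>
     int \<Rightarrow> grade \<Rightarrow> ('a syz \<Rightarrow>\<^sub>0 bit) \<Rightarrow> ('a syz \<Rightarrow>\<^sub>0 bit)" where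
  "f2 K F y i = (SOME \<phi>. bimodule_hom (Smod K F i) (Smod K F (i - 1)) \<phi> \<and>
     (\<forall>s. \<forall>v\<in>carrier (at_grade (Smod K F i) s). p2 (\<phi> s v) = f1 F y (p2 v)))"

definition h1 ::
  "'a set set \<Rightarrow> (grade \<Rightarrow> 'a set set) \<Rightarrow> ('a set \<Rightarrow> nat \<Rightarrow> 'a set \<Rightarrow> nat) \<Rightarrow>
     int \<Rightarrow> grade \<Rightarrow> ('a rel \<Rightarrow>\<^sub>0 bit) \<Rightarrow> ('a syz \<Rightarrow>\<^sub>0 bit)" where
  "h1 K F y i = (SOME \<phi>. bimodule_hom (Rmod K F i) (Smod K F (i - 2)) \<phi> \<and>
     (\<forall>s. \<forall>v\<in>carrier (at_grade (Rmod K F i) s).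
        p2 (\<phi> s v) = h0 F y (p1 v) + f1 F y (f1 F y v)))"

definition H0 ::
  "'a set set \<Rightarrow> (grade \<Rightarrow> 'a set set) \<Rightarrow> ('a set \<Rightarrow> nat \<Rightarrow> 'a set \<Rightarrow> nat) \<Rightarrow>
     int \<Rightarrow> grade \<Rightarrow> ('a gen \<Rightarrow>\<^sub>0 bit) \<Rightarrow> ('a syz \<Rightarrow>\<^sub>0 bit)" where
  "H0 K F y i = (SOME \<phi>. bimodule_hom (Gmod K F i) (Smod K F (i - 3)) \<phi> \<and>
     (\<forall>s. \<forall>v\<in>carrier (at_grade (Gmod K F i) s).
        p2 (\<phi> s v) = h0 F y (f0 y v) + f1 F y (h0 F y v)))"

definition log_path_complex ::
  "'a set set \<Rightarrow> (grade \<Rightarrow> 'a set set) \<Rightarrow> ('a set \<Rightarrow> nat \<Rightarrow> 'a set \<Rightarrow> nat) \<Rightarrow>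
     (('a gen \<Rightarrow>\<^sub>0 bit) \<times> ('a rel \<Rightarrow>\<^sub>0 bit) \<times> ('a syz \<Rightarrow>\<^sub>0 bit)) bicomplex" where
  "log_path_complex K F y =
     \<lparr>chains = (\<lambda>i. Gmod K F i \<oplus>\<^sub>m Rmod K F (i - 1) \<oplus>\<^sub>m Smod K F (i - 2)),
      bdry = (\<lambda>i s (u, v, w).
        (f0 y u + p1 v,
         h0 F y u + f1 F y v + p2 w,
         H0 K F y i s u + h1 K F y (i - 1) s v + f2 K F y (i - 2) s w))\<rparr>"

end

theory Submission
  imports Defs "HOL-Library.Product_Plus" "HOL.Modules"
begin

text \<open>At a fixed grade \<open>s\<close>, the generators of a simplex that are alive at \<open>s\<close> have consecutive
  indices, so an edge or a triangle is alive as soon as its outer vertices are. Every dyadic edge of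
  length greater than 1 is the long edge of exactly one triangle, which exchanges it for its two halves.
  Halving an edge down to unit edges therefore contracts \<open>G \<leftarrow> R \<leftarrow> S\<close> compatibly with the grading,
  and this contraction \<open>fill\<close> yields \<open>f\<^sup>2\<close>, \<open>h\<^sup>1\<close> and \<open>H\<^sup>0\<close> by composition with the right-hand
  sides of their defining equations. As \<open>p\<^sup>2\<close> is injective, the boundary map squares to zero, and the
  augmentation \<open>(u, v, w) \<mapsto> \<alpha> u\<close> is a quasi-isomorphism by a chase along the exact rows
  \<open>0 \<leftarrow> C \<leftarrow> G \<leftarrow> R \<leftarrow> S \<leftarrow> 0\<close>.\<close>

section \<open>Linear algebra over the field with two elements\<close>

text \<open>The three maps chosen by \<open>SOME\<close> are known only on the carriers, and there
  only through their images under \<open>p2\<close>. Since \<open>fill\<close> undoes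
  \<open>p2\<close> on carriers, each of them equals \<open>fill\<close> after the right-hand side
  of its equation. By additivity the last row of the matrix then merges into the single term
  \<open>fill (h0 F y u' + f1 F y v')\<close>, where \<open>u'\<close> and \<open>v'\<close> are the
  first two components of the boundary. So in the square of the boundary the third component
  vanishes as soon as the other two do, and the second vanishes because \<open>p1\<close> kills the
  argument of \<open>fill\<close>. All structure maps are identities on formal sums, so the work
  takes place inside single grades, where each module is the span of the basis elements alive there;
  choices made in a chase may depend on the grade. Coefficients in Z_2 remove signs, make additive
  maps linear and turn differences into sums.\<close>

lemma bit_poly_add_self [simp]:
  fixes v :: "'b \<Rightarrow>\<^sub>0 bit"
  shows "v + v = 0" "v + (v + w) = w"
proof -
  show "v + v = 0"
    by (rule poly_mapping_eqI) (simp add: lookup_add)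
  then show "v + (v + w) = w"
    by (simp flip: add.assoc)
qed

lemma bit_poly_add_eq_0_iff:
  fixes v w :: "'b \<Rightarrow>\<^sub>0 bit"
  shows "v + w = 0 \<longleftrightarrow> v = w"
  by (metis bit_poly_add_self(1) bit_poly_add_self(2) add.right_neutral)

lemma bit_poly_map_mult:
  "Poly_Mapping.map ((*) c) = (\<lambda>v :: 'b \<Rightarrow>\<^sub>0 bit. if c = 0 then 0 else v)"
  by (cases c) (auto intro!: poly_mapping_eqI simp: Poly_Mapping.map.rep_eq when_def)

lemma keys_basis_elem [simp]: "Poly_Mapping.keys (basis_elem b) = {b}"
  by (simp add: basis_elem_def)

text \<open>Keys of \<open>u + v\<close> may be lost to cancellation. Summing over a finite superset
  of the keys lets \<open>u\<close>, \<open>v\<close> and \<open>u + v\<close> be compared over one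
  index set.\<close>

lemma lin_ext_superset:
  assumes "finite A" "Poly_Mapping.keys v \<subseteq> A"
  shows "lin_ext \<phi> v = (\<Sum>b\<in>A. if Poly_Mapping.lookup v b = 0 then 0 else \<phi> b)"
  unfolding lin_ext_def using assms
  by (intro sum.mono_neutral_cong_left) (auto simp: in_keys_iff)

lemma additive_lin_ext [simp]:
  fixes \<phi> :: "'b \<Rightarrow> ('c \<Rightarrow>\<^sub>0 bit)"
  shows "additive (lin_ext \<phi>)"
proof
  fix u v :: "'b \<Rightarrow>\<^sub>0 bit"
  let ?A = "Poly_Mapping.keys u \<union> Poly_Mapping.keys v"
  have "lin_ext \<phi> (u + v) = (\<Sum>b\<in>?A. if Poly_Mapping.lookup (u + v) b = 0 then 0 else \<phi> b)"
    by (rule lin_ext_superset) (use Poly_Mapping.keys_add[of u v] in auto)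
  also have "\<dots> = (\<Sum>b\<in>?A. (if Poly_Mapping.lookup u b = 0 then 0 else \<phi> b)
                        + (if Poly_Mapping.lookup v b = 0 then 0 else \<phi> b))"
    by (intro sum.cong) (auto simp: lookup_add)
  also have "\<dots> = lin_ext \<phi> u + lin_ext \<phi> v"
    by (simp add: sum.distrib lin_ext_superset[of ?A])
  finally show "lin_ext \<phi> (u + v) = lin_ext \<phi> u + lin_ext \<phi> v" .
qed

lemmas lin_ext_add [simp] = additive.add[OF additive_lin_ext]

lemma lin_ext_0 [simp]: "lin_ext \<phi> 0 = 0"
  by (simp add: lin_ext_def)

lemma lin_ext_basis_elem [simp]: "lin_ext \<phi> (basis_elem b) = \<phi> b"
  by (simp add: lin_ext_def)

section \<open>Spans of sets of basis elements\<close>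

definition keys_span :: "'b set \<Rightarrow> ('b \<Rightarrow>\<^sub>0 bit) set" where
  "keys_span T = {v. Poly_Mapping.keys v \<subseteq> T}"

lemma basis_elem_in_keys_span [simp]: "basis_elem b \<in> keys_span T \<longleftrightarrow> b \<in> T"
  by (simp add: keys_span_def)

lemma keys_span_0 [simp]: "0 \<in> keys_span T"
  by (simp add: keys_span_def)

lemma keys_span_add [intro, simp]: "u \<in> keys_span T \<Longrightarrow> v \<in> keys_span T \<Longrightarrow> u + v \<in> keys_span T"
  unfolding keys_span_def using Poly_Mapping.keys_add[of u v] by blast

lemma keys_span_sum: "(\<And>a. a \<in> A \<Longrightarrow> f a \<in> keys_span T) \<Longrightarrow> (\<Sum>a\<in>A. f a) \<in> keys_span T"
  by (induction A rule: infinite_finite_induct) auto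

lemma keys_span_sum_list: "(\<And>a. a \<in> set xs \<Longrightarrow> f a \<in> keys_span T) \<Longrightarrow> (\<Sum>a\<leftarrow>xs. f a) \<in> keys_span T"
  by (induction xs) auto

lemma keys_span_mono: "S \<subseteq> T \<Longrightarrow> keys_span S \<subseteq> keys_span T"
  by (auto simp: keys_span_def)

lemma basis_elem_expansion: "(\<Sum>b\<in>Poly_Mapping.keys v. basis_elem b) = v"
proof (rule poly_mapping_eqI)
  fix k
  show "Poly_Mapping.lookup (\<Sum>b\<in>Poly_Mapping.keys v. basis_elem b) k = Poly_Mapping.lookup v k"
  proof (cases "k \<in> Poly_Mapping.keys v")
    case True
    then have "Poly_Mapping.lookup v k = 1"
      by (simp add: in_keys_iff)
    with True show ?thesis
      by (simp add: lookup_sum basis_elem_def lookup_single when_def)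
  next
    case False
    then show ?thesis
      by (simp add: lookup_sum basis_elem_def lookup_single when_def in_keys_iff)
  qed
qed

text \<open>Every nonzero coefficient is 1, so a vector is the plain sum of its keys and no case for
  scalars is needed.\<close>

lemma keys_span_induct [consumes 1, case_names zero basis add]:
  assumes "v \<in> keys_span T"
    and "P 0"
    and "\<And>b. b \<in> T \<Longrightarrow> P (basis_elem b)"
    and "\<And>u v. u \<in> keys_span T \<Longrightarrow> v \<in> keys_span T \<Longrightarrow> P u \<Longrightarrow> P v \<Longrightarrow> P (u + v)"
  shows "P v"
proof -
  have "finite A \<Longrightarrow> A \<subseteq> T \<Longrightarrow> P (\<Sum>b\<in>A. basis_elem b)" for A
    by (induction A rule: finite_induct) (use assms(2,3) in \<open>auto intro!: assms(4) keys_span_sum\<close>)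
  from this[of "Poly_Mapping.keys v"] assms(1) show ?thesis
    by (simp add: basis_elem_expansion keys_span_def)
qed

lemma keys_span_UNIV [simp]: "v \<in> keys_span UNIV"
  by (simp add: keys_span_def)

text \<open>The codomain may be any abelian group: \<open>free_bimodule_sum3\<close> compares maps
  into triples.\<close>

lemma additive_eq_on_keys_span:
  assumes "v \<in> keys_span T" "additive f" "additive g"
    and "\<And>b. b \<in> T \<Longrightarrow> f (basis_elem b) = g (basis_elem b)"
  shows "f v = g v"
  using assms(1)
  by (induction rule: keys_span_induct)
     (use assms in \<open>auto simp: additive.zero additive.add\<close>)

lemma additive_in_keys_span:
  fixes f :: "('b \<Rightarrow>\<^sub>0 bit) \<Rightarrow> ('c \<Rightarrow>\<^sub>0 bit)"
  assumes "v \<in> keys_span T" "additive f"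
    and "\<And>b. b \<in> T \<Longrightarrow> f (basis_elem b) \<in> keys_span T'"
  shows "f v \<in> keys_span T'"
  using assms(1)
  by (induction rule: keys_span_induct)
     (use assms in \<open>auto simp: additive.zero additive.add\<close>)

lemma lin_ext_in_keys_span:
  fixes \<phi> :: "'b \<Rightarrow> ('c \<Rightarrow>\<^sub>0 bit)"
  assumes "v \<in> keys_span T" "\<And>b. b \<in> T \<Longrightarrow> \<phi> b \<in> keys_span T'"
  shows "lin_ext \<phi> v \<in> keys_span T'"
  by (rule additive_in_keys_span[OF assms(1)]) (simp_all add: assms(2))

section \<open>Bipersistence modules\<close>

lemma vector_space_of_simps [simp]:
  "carrier (vector_space_of V z p m) = V" "zero (vector_space_of V z p m) = z"
  "add (vector_space_of V z p m) = p" "smult (vector_space_of V z p m) = m"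
  by (simp_all add: vector_space_of_def)

lemma cring_Z2: "cring Z2"
proof (rule cringI)
  show "abelian_group Z2"
  proof (rule abelian_groupI)
    show "\<exists>y\<in>carrier Z2. y \<oplus>\<^bsub>Z2\<^esub> x = \<zero>\<^bsub>Z2\<^esub>" for x
      by (rule bexI[of _ x]) (simp_all add: Z2_def)
  qed (simp_all only: Z2_def partial_object.simps ring.simps ac_simps add_0 add_0_right UNIV_I)
  show "Group.comm_monoid Z2"
    by (rule comm_monoidI) (simp_all add: Z2_def ac_simps)
qed (simp only: Z2_def partial_object.simps monoid.simps ring.simps distrib_right)

text \<open>The hypothesis \<open>p u u = z\<close> supplies negatives, each vector being its own.
  The scalars are 0 and 1, so the scalar laws are finite case checks.\<close>

lemma module_Z2_vector_space_of:
  assumes "\<And>u v. u \<in> V \<Longrightarrow> v \<in> V \<Longrightarrow> p u v \<in> V" "z \<in> V"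
    and "\<And>u v w. u \<in> V \<Longrightarrow> v \<in> V \<Longrightarrow> w \<in> V \<Longrightarrow> p (p u v) w = p u (p v w)"
    and comm: "\<And>u v. u \<in> V \<Longrightarrow> v \<in> V \<Longrightarrow> p u v = p v u"
    and "\<And>u. u \<in> V \<Longrightarrow> p z u = u"
    and "\<And>u. u \<in> V \<Longrightarrow> p u u = z"
    and m: "\<And>u. u \<in> V \<Longrightarrow> m 0 u = z" "\<And>u. u \<in> V \<Longrightarrow> m 1 u = u"
  shows "Module.module Z2 (vector_space_of V z p m)" (is "Module.module Z2 ?M")
proof (rule moduleI)
  show "cring Z2" by (rule cring_Z2)
  show "abelian_group ?M"
  proof (rule abelian_groupI)
    show "\<exists>y\<in>carrier ?M. y \<oplus>\<^bsub>?M\<^esub> x = \<zero>\<^bsub>?M\<^esub>" if "x \<in> carrier ?M" for x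
      by (rule bexI[of _ x]) (use that assms(6) in simp_all)
  qed (use assms(1-3,5) comm in \<open>auto\<close>)
  fix a b :: bit and x y
  assume "x \<in> carrier ?M"
  then have x: "x \<in> V" by simp
  show "a \<odot>\<^bsub>?M\<^esub> x \<in> carrier ?M"
    by (cases a) (use x assms(1-3,5-) comm[of z] in auto)
  show "(a \<oplus>\<^bsub>Z2\<^esub> b) \<odot>\<^bsub>?M\<^esub> x =
    a \<odot>\<^bsub>?M\<^esub> x \<oplus>\<^bsub>?M\<^esub> b \<odot>\<^bsub>?M\<^esub> x"
    by (cases a; cases b) (use x assms(1-3,5-) comm[of z] in \<open>auto simp: Z2_def\<close>)
  show "(a \<otimes>\<^bsub>Z2\<^esub> b) \<odot>\<^bsub>?M\<^esub> x =
    a \<odot>\<^bsub>?M\<^esub> (b \<odot>\<^bsub>?M\<^esub> x)"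
    by (cases a; cases b) (use x assms(1-3,5-) comm[of z] in \<open>auto simp: Z2_def\<close>)
  show "\<one>\<^bsub>Z2\<^esub> \<odot>\<^bsub>?M\<^esub> x = x"
    using x m by (simp add: Z2_def)
  assume "y \<in> carrier ?M"
  then have y: "y \<in> V" by simp
  show "a \<odot>\<^bsub>?M\<^esub> (x \<oplus>\<^bsub>?M\<^esub> y) =
    a \<odot>\<^bsub>?M\<^esub> x \<oplus>\<^bsub>?M\<^esub> a \<odot>\<^bsub>?M\<^esub> y"
    by (cases a) (use x y assms(1-3,5-) in auto)
qed

lemma module_Z2_smult:
  assumes "Module.module Z2 V" "x \<in> carrier V"
  shows "0 \<odot>\<^bsub>V\<^esub> x = \<zero>\<^bsub>V\<^esub>" "1 \<odot>\<^bsub>V\<^esub> x = x"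
proof -
  interpret Module.module Z2 V by fact
  show "1 \<odot>\<^bsub>V\<^esub> x = x" using smult_one[OF assms(2)] by (simp add: Z2_def)
  show "0 \<odot>\<^bsub>V\<^esub> x = \<zero>\<^bsub>V\<^esub>" using smult_l_null[OF assms(2)] by (simp add: Z2_def)
qed

lemma module_Z2_add_self:
  assumes "Module.module Z2 V" "x \<in> carrier V"
  shows "x \<oplus>\<^bsub>V\<^esub> x = \<zero>\<^bsub>V\<^esub>"
proof -
  interpret Module.module Z2 V by fact
  have "(1 \<oplus>\<^bsub>Z2\<^esub> 1) \<odot>\<^bsub>V\<^esub> x = 1 \<odot>\<^bsub>V\<^esub> x \<oplus>\<^bsub>V\<^esub> 1 \<odot>\<^bsub>V\<^esub> x"
    by (rule smult_l_distr) (use assms in \<open>auto simp: Z2_def\<close>)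
  then show ?thesis
    using module_Z2_smult[OF assms] by (simp add: Z2_def)
qed

text \<open>Over Z_2 additivity suffices: a vector added to itself gives zero, which forces
  \<open>f\<close> to preserve zero, and only the scalars 0 and 1 remain.\<close>

lemma linear_mapI:
  assumes "Module.module Z2 V" "Module.module Z2 W"
    and f: "\<And>x. x \<in> carrier V \<Longrightarrow> f x \<in> carrier W"
    and add: "\<And>x y. x \<in> carrier V \<Longrightarrow> y \<in> carrier V \<Longrightarrow> f (x \<oplus>\<^bsub>V\<^esub> y) = f x \<oplus>\<^bsub>W\<^esub> f y"
  shows "linear_map V W f"
proof -
  interpret V: Module.module Z2 V by fact
  interpret W: Module.module Z2 W by fact
  have "f (\<zero>\<^bsub>V\<^esub> \<oplus>\<^bsub>V\<^esub> \<zero>\<^bsub>V\<^esub>) = f \<zero>\<^bsub>V\<^esub> \<oplus>\<^bsub>W\<^esub> f \<zero>\<^bsub>V\<^esub>"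
    by (rule add) auto
  then have "f \<zero>\<^bsub>V\<^esub> = \<zero>\<^bsub>W\<^esub>"
    by (simp add: module_Z2_add_self[OF assms(2)] f)
  then have "f (c \<odot>\<^bsub>V\<^esub> x) = c \<odot>\<^bsub>W\<^esub> f x" if "x \<in> carrier V" for c x
    by (cases c) (use that f in \<open>simp_all add: module_Z2_smult[OF assms(1)] module_Z2_smult[OF assms(2)]\<close>)
  with assms show ?thesis
    by (auto simp: linear_map_def)
qed

lemma linear_map_zero:
  assumes "Module.module Z2 V" "Module.module Z2 W" "linear_map V W f"
  shows "f \<zero>\<^bsub>V\<^esub> = \<zero>\<^bsub>W\<^esub>"
proof -
  interpret V: Module.module Z2 V by fact
  have "f (0 \<odot>\<^bsub>V\<^esub> \<zero>\<^bsub>V\<^esub>) = 0 \<odot>\<^bsub>W\<^esub> f \<zero>\<^bsub>V\<^esub>" "f \<zero>\<^bsub>V\<^esub> \<in> carrier W"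
    using assms(3) V.zero_closed unfolding linear_map_def by blast+
  then show ?thesis
    by (simp add: module_Z2_smult[OF assms(1)] module_Z2_smult[OF assms(2)])
qed

lemma bipersistence_moduleI:
  assumes "\<And>s. Module.module Z2 (at_grade M s)"
    and "\<And>s t. s \<le> t \<Longrightarrow> linear_map (at_grade M s) (at_grade M t) (shift M s t)"
    and "\<And>s v. v \<in> carrier (at_grade M s) \<Longrightarrow> shift M s s v = v"
    and "\<And>r s t v. r \<le> s \<Longrightarrow> s \<le> t \<Longrightarrow> v \<in> carrier (at_grade M r) \<Longrightarrow>
      shift M s t (shift M r s v) = shift M r t v"
  shows "bipersistence_module M"
  unfolding bipersistence_module_def by (intro conjI allI ballI impI assms)

lemma bipersistence_moduleD:
  assumes "bipersistence_module M"
  shows "Module.module Z2 (at_grade M s)"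
    and "s \<le> t \<Longrightarrow> linear_map (at_grade M s) (at_grade M t) (shift M s t)"
    and "v \<in> carrier (at_grade M s) \<Longrightarrow> shift M s s v = v"
    and "r \<le> s \<Longrightarrow> s \<le> t \<Longrightarrow> v \<in> carrier (at_grade M r) \<Longrightarrow>
      shift M s t (shift M r s v) = shift M r t v"
  using assms unfolding bipersistence_module_def by (auto simp del: split_paired_All)

lemma bipersistence_module_bimodule_sum:
  assumes "bipersistence_module M" "bipersistence_module N"
  shows "bipersistence_module (M \<oplus>\<^sub>m N)"
proof -
  have M: "Module.module Z2 (at_grade M s)" and N: "Module.module Z2 (at_grade N s)" for s
    by (fact bipersistence_moduleD(1)[OF assms(1)] bipersistence_moduleD(1)[OF assms(2)])+
  have mod: "Module.module Z2 (at_grade (M \<oplus>\<^sub>m N) s)" for s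
  proof -
    interpret M: Module.module Z2 "at_grade M s" by (rule M)
    interpret N: Module.module Z2 "at_grade N s" by (rule N)
    show ?thesis
      unfolding bimodule_sum_def
      by (simp, rule module_Z2_vector_space_of)
         (auto simp: M.a_assoc N.a_assoc module_Z2_smult[OF M] module_Z2_smult[OF N]
            module_Z2_add_self[OF M] module_Z2_add_self[OF N]
            intro: M.a_comm N.a_comm M.zero_closed N.zero_closed)
  qed
  note M1 = bipersistence_moduleD(2)[OF assms(1)] and N1 = bipersistence_moduleD(2)[OF assms(2)]
  have "linear_map (at_grade (M \<oplus>\<^sub>m N) s) (at_grade (M \<oplus>\<^sub>m N) t) (shift (M \<oplus>\<^sub>m N) s t)" if "s \<le> t" for s t
    by (rule linear_mapI[OF mod mod])
       (use M1[OF that] N1[OF that] in \<open>auto simp: bimodule_sum_def linear_map_def\<close>)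
  moreover have "v \<in> carrier (at_grade (M \<oplus>\<^sub>m N) s) \<Longrightarrow> shift (M \<oplus>\<^sub>m N) s s v = v" for s v
    by (auto simp: bimodule_sum_def bipersistence_moduleD(3)[OF assms(1)] bipersistence_moduleD(3)[OF assms(2)])
  moreover have "r \<le> s \<Longrightarrow> s \<le> t \<Longrightarrow> v \<in> carrier (at_grade (M \<oplus>\<^sub>m N) r) \<Longrightarrow>
      shift (M \<oplus>\<^sub>m N) s t (shift (M \<oplus>\<^sub>m N) r s v) = shift (M \<oplus>\<^sub>m N) r t v" for r s t v
    using bipersistence_moduleD(4)[OF assms(1), of r s t "fst v"]
      bipersistence_moduleD(4)[OF assms(2), of r s t "snd v"]
    by (cases v) (simp add: bimodule_sum_def)
  ultimately show ?thesis
    using mod by (intro bipersistence_moduleI)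
qed

section \<open>Sums of upset modules at a single grade\<close>

definition live_at :: "'b set \<Rightarrow> ('b \<Rightarrow> grade set) \<Rightarrow> grade \<Rightarrow> 'b set" where
  "live_at B A s = {b \<in> B. \<exists>a\<in>A b. a \<le> s}"

lemma live_at_mono: "s \<le> t \<Longrightarrow> live_at B A s \<subseteq> live_at B A t"
  unfolding live_at_def using order_trans by blast

lemma at_grade_upset_sum:
  "at_grade (upset_sum B A) s = vector_space_of (keys_span (live_at B A s)) 0 (+) (\<lambda>c v. if c = 0 then 0 else v)"
proof -
  have "{v. Poly_Mapping.keys v \<subseteq> B \<and>
            (\<forall>b\<in>B. Poly_Mapping.lookup v b \<in> carrier (at_grade (upset_module (A b)) s))}
     = keys_span (live_at B A s)"
    by (auto simp: upset_module_def keys_span_def live_at_def in_keys_iff subset_iff)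
  then show ?thesis
    unfolding upset_sum_def by (simp only: bimodule.simps bit_poly_map_mult)
qed

lemma carrier_upset_sum [simp]:
  "carrier (at_grade (upset_sum B A) s) = keys_span (live_at B A s)"
  "zero (at_grade (upset_sum B A) s) = 0" "add (at_grade (upset_sum B A) s) = (+)"
  "shift (upset_sum B A) s t = (\<lambda>v. v)"
  by (simp_all add: at_grade_upset_sum) (simp add: upset_sum_def)

lemma bipersistence_module_upset_sum: "bipersistence_module (upset_sum B A)"
proof -
  have mod: "Module.module Z2 (at_grade (upset_sum B A) s)" for s
    unfolding at_grade_upset_sum
    by (rule module_Z2_vector_space_of) (auto simp: add_ac intro: keys_span_0)
  have "linear_map (at_grade (upset_sum B A) s) (at_grade (upset_sum B A) t) (\<lambda>v. v)" if "s \<le> t" for s t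
    by (rule linear_mapI[OF mod mod]) (use keys_span_mono[OF live_at_mono[OF that]] in auto)
  with mod show ?thesis
    by (simp add: bipersistence_module_def)
qed

section \<open>Homology\<close>

text \<open>Homology is a quotient of the chains with carrier cut down to the cycles. Cosets and
  their sums use only the addition, so they can be computed in the whole chain space; the
  restriction survives only in the set of representatives.\<close>

lemma a_r_coset_update [simp]: "a_r_coset (M\<lparr>carrier := Z\<rparr>) = a_r_coset (M :: ('r, 'v) module)"
  by (intro ext) (simp add: a_r_coset_def')

lemma set_add_update [simp]: "set_add (M\<lparr>carrier := Z\<rparr>) = set_add (M :: ('r, 'v) module)"
  by (intro ext) (simp add: set_add_def')

lemma a_rcosets_update:
  "a_rcosets\<^bsub>M\<lparr>carrier := Z\<rparr>\<^esub> B = (a_r_coset M B) ` Z" for M :: "('r, 'v) module"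
  by (auto simp: A_RCOSETS_def' a_r_coset_def')

text \<open>Closure under negatives is automatic, as each element is its own negative.\<close>

lemma abelian_subgroup_Z2I:
  assumes "Module.module Z2 M" "B \<subseteq> carrier M" "\<zero>\<^bsub>M\<^esub> \<in> B"
    and "\<And>x y. x \<in> B \<Longrightarrow> y \<in> B \<Longrightarrow> x \<oplus>\<^bsub>M\<^esub> y \<in> B"
  shows "abelian_subgroup B M"
proof -
  interpret M: Module.module Z2 M by fact
  have "a_inv M x = x" if "x \<in> B" for x
    using that assms module_Z2_add_self[OF assms(1), of x]
    by (metis M.minus_equality subsetD)
  then have "additive_subgroup B M"
    by (intro additive_subgroupI M.a_group group.subgroupI[OF M.a_group])
       (use assms in \<open>auto simp flip: a_inv_def\<close>)
  then show ?thesis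
    by (intro abelian_subgroupI3) (auto intro: M.abelian_group_axioms)
qed

lemma coset_eq_iff:
  assumes "Module.module Z2 M" "abelian_subgroup B M" "x \<in> carrier M" "y \<in> carrier M"
  shows "B +>\<^bsub>M\<^esub> x = B +>\<^bsub>M\<^esub> y \<longleftrightarrow> x \<oplus>\<^bsub>M\<^esub> y \<in> B"
proof -
  interpret M: Module.module Z2 M by fact
  interpret B: abelian_subgroup B M by fact
  have inv: "a_inv M y = y"
    using assms module_Z2_add_self[OF assms(1), of y] by (metis M.minus_equality)
  have "B +>\<^bsub>M\<^esub> x = B +>\<^bsub>M\<^esub> y \<longleftrightarrow> x \<in> B +>\<^bsub>M\<^esub> y"
    using B.a_repr_independence'[of x y] B.a_rcos_self[of x] assms by auto
  also have "\<dots> \<longleftrightarrow> x \<oplus>\<^bsub>M\<^esub> y \<in> B"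
    using B.a_rcos_module[OF assms(4,3)] inv by simp
  finally show ?thesis .
qed

text \<open>Members of the coset differ from \<open>z\<close> by elements of \<open>B\<close>, which
  \<open>g\<close> moves into \<open>B'\<close>; the union therefore runs over one repeated coset.
  This evaluates all three operations defined by unions: scaling, structure maps and induced maps on
  homology.\<close>

lemma UN_coset_image:
  assumes M: "Module.module Z2 M" "abelian_subgroup B M"
    and M': "Module.module Z2 M'" "abelian_subgroup B' M'"
    and g: "linear_map M M' g" "g ` B \<subseteq> B'" and z: "z \<in> carrier M"
  shows "(\<Union>v\<in>B +>\<^bsub>M\<^esub> z. B' +>\<^bsub>M'\<^esub> g v) = B' +>\<^bsub>M'\<^esub> g z"
proof -
  interpret M: Module.module Z2 M by fact
  interpret M': Module.module Z2 M' by fact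
  interpret B: abelian_subgroup B M by fact
  interpret B': abelian_subgroup B' M' by fact
  have gc: "g x \<in> carrier M'" if "x \<in> carrier M" for x
    using g that by (auto simp: linear_map_def)
  have *: "B' +>\<^bsub>M'\<^esub> g v = B' +>\<^bsub>M'\<^esub> g z" if v: "v \<in> B +>\<^bsub>M\<^esub> z" for v
  proof -
    obtain b where b: "b \<in> B" "v = b \<oplus>\<^bsub>M\<^esub> z"
      using v by (auto simp: a_r_coset_def')
    have bc: "b \<in> carrier M" "g b \<in> carrier M'"
      using b gc by (auto intro: B.a_Hcarr)
    have "g v \<oplus>\<^bsub>M'\<^esub> g z = g b \<oplus>\<^bsub>M'\<^esub> (g z \<oplus>\<^bsub>M'\<^esub> g z)"
      using b bc z g gc by (simp add: linear_map_def M'.a_assoc)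
    also have "\<dots> = g b"
      using bc gc[OF z] by (simp add: module_Z2_add_self[OF M'(1)])
    finally have "g v \<oplus>\<^bsub>M'\<^esub> g z \<in> B'"
      using g b by auto
    moreover have "g v \<in> carrier M'"
      using b bc z gc by simp
    ultimately show ?thesis
      using coset_eq_iff[OF M'] gc z by simp
  qed
  have "(\<Union>v\<in>B +>\<^bsub>M\<^esub> z. B' +>\<^bsub>M'\<^esub> g v) = (\<Union>v\<in>B +>\<^bsub>M\<^esub> z. B' +>\<^bsub>M'\<^esub> g z)"
    by (rule SUP_cong) (simp_all add: *)
  also have "\<dots> = B' +>\<^bsub>M'\<^esub> g z"
    using B.a_rcos_self[OF z] by (simp only: UN_constant) auto
  finally show ?thesis .
qed

lemma chain_complexD:
  assumes "chain_complex X"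
  shows "Module.module Z2 (chains_at X i s)"
    and "linear_map (chains_at X i s) (chains_at X (i - 1) s) (bdry X i s)"
    and "linear_map (chains_at X (i + 1) s) (chains_at X i s) (bdry X (i + 1) s)"
proof -
  show "Module.module Z2 (chains_at X i s)"
    using assms unfolding chain_complex_def by (blast intro: bipersistence_moduleD)
  show *: "linear_map (chains_at X i s) (chains_at X (i - 1) s) (bdry X i s)" for i
    using assms unfolding chain_complex_def bimodule_hom_def by blast
  show "linear_map (chains_at X (i + 1) s) (chains_at X i s) (bdry X (i + 1) s)"
    using *[of "i + 1"] by simp
qed

lemma chain_mapD:
  assumes "chain_map X Y f"
  shows "linear_map (chains_at X i s) (chains_at Y i s) (f i s)"
    and "v \<in> carrier (chains_at X i s) \<Longrightarrow> f (i - 1) s (bdry X i s v) = bdry Y i s (f i s v)"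
  using assms unfolding chain_map_def bimodule_hom_def by blast+

lemma abelian_subgroup_boundaries:
  assumes "chain_complex X"
  shows "abelian_subgroup (boundaries X i s) (chains_at X i s)"
proof -
  note mod = chain_complexD(1)[OF assms] and lin = chain_complexD(3)[OF assms, of i s]
  interpret M: Module.module Z2 "chains_at X (i + 1) s" by (rule mod)
  have add: "bdry X (i + 1) s x \<oplus>\<^bsub>chains_at X i s\<^esub> bdry X (i + 1) s y \<in> boundaries X i s"
    if "x \<in> carrier (chains_at X (i + 1) s)" "y \<in> carrier (chains_at X (i + 1) s)" for x y
  proof -
    have "bdry X (i + 1) s (x \<oplus>\<^bsub>chains_at X (i + 1) s\<^esub> y) =
        bdry X (i + 1) s x \<oplus>\<^bsub>chains_at X i s\<^esub> bdry X (i + 1) s y"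
      using lin that by (simp add: linear_map_def)
    then show ?thesis
      using M.a_closed[OF that] unfolding boundaries_def by (metis image_eqI)
  qed
  show ?thesis
  proof (rule abelian_subgroup_Z2I[OF mod])
    show "boundaries X i s \<subseteq> carrier (chains_at X i s)"
      using lin by (auto simp: boundaries_def linear_map_def)
    show "\<zero>\<^bsub>chains_at X i s\<^esub> \<in> boundaries X i s"
      using linear_map_zero[OF mod mod lin] unfolding boundaries_def
      by (metis M.zero_closed image_eqI)
    show "x \<oplus>\<^bsub>chains_at X i s\<^esub> y \<in> boundaries X i s"
      if "x \<in> boundaries X i s" "y \<in> boundaries X i s" for x y
      using that add by (auto simp: boundaries_def)
  qed
qed

text \<open>Cycles of \<open>Y\<close> are required to lift exactly, not only up to a boundary; the
  augmentation satisfies this stronger form. Injectivity comes from applying \<open>reflect\<close>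
  to the sum of two representatives.\<close>

lemma bimodule_iso_homology:
  assumes X: "chain_complex X" and Y: "chain_complex Y" and f: "chain_map X Y f"
    and onto: "\<And>i s c. c \<in> cycles Y i s \<Longrightarrow> \<exists>z\<in>cycles X i s. f i s z = c"
    and reflect: "\<And>i s z. z \<in> cycles X i s \<Longrightarrow> f i s z \<in> boundaries Y i s \<Longrightarrow> z \<in> boundaries X i s"
  shows "bimodule_iso (homology X i) (homology Y i) (homology_map Y f i)"
proof -
  note modX = chain_complexD(1)[OF X] and modY = chain_complexD(1)[OF Y]
  note subX = abelian_subgroup_boundaries[OF X] and subY = abelian_subgroup_boundaries[OF Y]
  note linf = chain_mapD(1)[OF f]
  have fb: "f i s ` boundaries X i s \<subseteq> boundaries Y i s" for s
  proof -
    have "f i s (bdry X (i + 1) s v) = bdry Y (i + 1) s (f (i + 1) s v)"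
      if "v \<in> carrier (chains_at X (i + 1) s)" for v
      using chain_mapD(2)[OF f that] by simp
    then show ?thesis
      using linf[of "i + 1" s] by (auto simp: boundaries_def linear_map_def)
  qed
  have fZ: "f i s z \<in> cycles Y i s" if "z \<in> cycles X i s" for s z
  proof -
    have "bdry Y i s (f i s z) = f (i - 1) s (bdry X i s z)"
      using chain_mapD(2)[OF f, of z i s] that by (simp add: cycles_def)
    also have "\<dots> = \<zero>\<^bsub>chains_at Y (i - 1) s\<^esub>"
      using that linear_map_zero[OF modX modY linf] by (simp add: cycles_def)
    finally show ?thesis
      using that linf[of i s] by (auto simp: cycles_def linear_map_def)
  qed
  have car: "z \<in> carrier (chains_at C i s)" if "z \<in> cycles C i s" for z s and C :: "'c bicomplex"
    using that by (simp add: cycles_def)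
  have hom: "carrier (at_grade (homology C i) s) = (\<lambda>z. boundaries C i s +>\<^bsub>chains_at C i s\<^esub> z) ` cycles C i s"
    "add (at_grade (homology C i) s) = (\<lambda>A B. A <+>\<^bsub>chains_at C i s\<^esub> B)"
    "smult (at_grade (homology C i) s) = (\<lambda>c A. \<Union>x\<in>A. boundaries C i s +>\<^bsub>chains_at C i s\<^esub> (c \<odot>\<^bsub>chains_at C i s\<^esub> x))"
    for s and C :: "'c bicomplex"
    by (simp_all add: homology_def quotient_space_def a_rcosets_update)
  have hmap: "homology_map Y f i s (boundaries X i s +>\<^bsub>chains_at X i s\<^esub> z) =
      boundaries Y i s +>\<^bsub>chains_at Y i s\<^esub> f i s z" if "z \<in> cycles X i s" for s z
    unfolding homology_map_def
    by (rule UN_coset_image[OF modX subX modY subY linf fb car[OF that]])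
  have cyc_add: "x \<oplus>\<^bsub>chains_at C i s\<^esub> y \<in> cycles C i s"
    if "chain_complex C" "x \<in> cycles C i s" "y \<in> cycles C i s" for s x y and C :: "'c bicomplex"
  proof -
    note mod = chain_complexD(1)[OF that(1)]
    interpret M: Module.module Z2 "chains_at C i s" by (rule mod)
    interpret M': Module.module Z2 "chains_at C (i - 1) s" by (rule mod)
    have "linear_map (chains_at C i s) (chains_at C (i - 1) s) (bdry C i s)"
      by (rule chain_complexD(2)[OF that(1)])
    with that(2,3) show ?thesis
      by (simp add: cycles_def linear_map_def)
  qed
  have coset_add: "(boundaries C i s +>\<^bsub>chains_at C i s\<^esub> x) <+>\<^bsub>chains_at C i s\<^esub> (boundaries C i s +>\<^bsub>chains_at C i s\<^esub> y)
      = boundaries C i s +>\<^bsub>chains_at C i s\<^esub> (x \<oplus>\<^bsub>chains_at C i s\<^esub> y)"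
    if "chain_complex C" "x \<in> cycles C i s" "y \<in> cycles C i s" for s x y and C :: "'c bicomplex"
    by (rule abelian_subgroup.a_rcos_sum[OF abelian_subgroup_boundaries[OF that(1)]])
       (use that in \<open>simp_all add: cycles_def\<close>)
  have coset_smult: "(\<Union>v\<in>boundaries C i s +>\<^bsub>chains_at C i s\<^esub> x. boundaries C i s +>\<^bsub>chains_at C i s\<^esub> (c \<odot>\<^bsub>chains_at C i s\<^esub> v))
      = boundaries C i s +>\<^bsub>chains_at C i s\<^esub> (c \<odot>\<^bsub>chains_at C i s\<^esub> x)"
      and cyc_smult: "c \<odot>\<^bsub>chains_at C i s\<^esub> x \<in> cycles C i s"
    if C: "chain_complex C" and x: "x \<in> cycles C i s" for s c x and C :: "'c bicomplex"
  proof -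
    note mod = chain_complexD(1)[OF that(1)]
    interpret M: Module.module Z2 "chains_at C i s" by (rule mod)
    interpret M': Module.module Z2 "chains_at C (i - 1) s" by (rule mod)
    note sub = abelian_subgroup_boundaries[OF C, of i s]
    have Bc: "v \<in> carrier (chains_at C i s)" if "v \<in> boundaries C i s" for v
      using sub that abelian_subgroup.axioms(1) additive_subgroup.a_Hcarr by metis
    have Z2: "c \<in> carrier Z2"
      by (simp add: Z2_def)
    have "linear_map (chains_at C i s) (chains_at C i s) (\<lambda>v. c \<odot>\<^bsub>chains_at C i s\<^esub> v)"
      by (rule linear_mapI[OF mod mod]) (use Z2 M.smult_r_distr in auto)
    moreover have "(\<lambda>v. c \<odot>\<^bsub>chains_at C i s\<^esub> v) ` boundaries C i s \<subseteq> boundaries C i s"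
      using Bc abelian_subgroup.axioms(1)[OF sub]
      by (cases c) (auto simp: module_Z2_smult[OF mod] additive_subgroup.zero_closed)
    ultimately show "(\<Union>v\<in>boundaries C i s +>\<^bsub>chains_at C i s\<^esub> x. boundaries C i s +>\<^bsub>chains_at C i s\<^esub> (c \<odot>\<^bsub>chains_at C i s\<^esub> v))
      = boundaries C i s +>\<^bsub>chains_at C i s\<^esub> (c \<odot>\<^bsub>chains_at C i s\<^esub> x)"
      by (rule UN_coset_image[OF mod sub mod sub _ _ car[OF x]])
    have "linear_map (chains_at C i s) (chains_at C (i - 1) s) (bdry C i s)"
      by (rule chain_complexD(2)[OF C])
    with x show "c \<odot>\<^bsub>chains_at C i s\<^esub> x \<in> cycles C i s"
      by (cases c) (auto simp: cycles_def module_Z2_smult[OF mod] linear_map_zero[OF mod mod])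
  qed
  have lin: "linear_map (at_grade (homology X i) s) (at_grade (homology Y i) s) (homology_map Y f i s)" for s
    unfolding linear_map_def hom
  proof (intro conjI ballI allI)
    show "homology_map Y f i s \<in> (a_r_coset (chains_at X i s) (boundaries X i s)) ` cycles X i s
        \<rightarrow> (a_r_coset (chains_at Y i s) (boundaries Y i s)) ` cycles Y i s"
      by (auto simp: hmap fZ)
    fix A B
    assume "A \<in> (a_r_coset (chains_at X i s) (boundaries X i s)) ` cycles X i s"
    then obtain x where x: "x \<in> cycles X i s" and A: "A = boundaries X i s +>\<^bsub>chains_at X i s\<^esub> x"
      by auto
    show "homology_map Y f i s (\<Union>x\<in>A. boundaries X i s +>\<^bsub>chains_at X i s\<^esub> (c \<odot>\<^bsub>chains_at X i s\<^esub> x)) =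
      (\<Union>x\<in>homology_map Y f i s A. boundaries Y i s +>\<^bsub>chains_at Y i s\<^esub> (c \<odot>\<^bsub>chains_at Y i s\<^esub> x))" for c
      using linf[of i s] car[OF x]
      by (simp add: A coset_smult[OF X x] hmap[OF x] hmap[OF cyc_smult[OF X x]] coset_smult[OF Y fZ[OF x]] linear_map_def)
    assume "B \<in> (a_r_coset (chains_at X i s) (boundaries X i s)) ` cycles X i s"
    then obtain y where y: "y \<in> cycles X i s" and B: "B = boundaries X i s +>\<^bsub>chains_at X i s\<^esub> y"
      by auto
    show "homology_map Y f i s (A <+>\<^bsub>chains_at X i s\<^esub> B) =
        homology_map Y f i s A <+>\<^bsub>chains_at Y i s\<^esub> homology_map Y f i s B"
      using linf[of i s] car[OF x] car[OF y]
      by (simp add: A B coset_add[OF X x y] hmap[OF x] hmap[OF y] hmap[OF cyc_add[OF X x y]]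
          coset_add[OF Y fZ[OF x] fZ[OF y]] linear_map_def)
  qed
  have shift_coset: "shift (homology C i) s t (boundaries C i s +>\<^bsub>chains_at C i s\<^esub> z)
      = boundaries C i t +>\<^bsub>chains_at C i t\<^esub> shift (chains C i) s t z"
    and shift_cyc: "shift (chains C i) s t z \<in> cycles C i t"
    if C: "chain_complex C" and st: "s \<le> t" and z: "z \<in> cycles C i s" for s t z and C :: "'c bicomplex"
  proof -
    note mod = chain_complexD(1)[OF C]
    have lin: "linear_map (chains_at C j s) (chains_at C j t) (shift (chains C j) s t)" for j
      using C st unfolding chain_complex_def by (blast intro: bipersistence_moduleD)
    have nat: "bdry C j t (shift (chains C j) s t v) = shift (chains C (j - 1)) s t (bdry C j s v)"
      if "v \<in> carrier (chains_at C j s)" for j v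
      using C st that unfolding chain_complex_def bimodule_hom_def by blast
    have "shift (chains C i) s t ` boundaries C i s \<subseteq> boundaries C i t"
    proof
      fix b assume "b \<in> shift (chains C i) s t ` boundaries C i s"
      then obtain v where v: "v \<in> carrier (chains_at C (i + 1) s)"
        and b: "b = shift (chains C i) s t (bdry C (i + 1) s v)"
        by (auto simp: boundaries_def)
      have "b = bdry C (i + 1) t (shift (chains C (i + 1)) s t v)"
        using nat[OF v] b by simp
      moreover have "shift (chains C (i + 1)) s t v \<in> carrier (chains_at C (i + 1) t)"
        using lin[of "i + 1"] v by (auto simp: linear_map_def)
      ultimately show "b \<in> boundaries C i t"
        unfolding boundaries_def by blast
    qed
    then show "shift (homology C i) s t (boundaries C i s +>\<^bsub>chains_at C i s\<^esub> z)
      = boundaries C i t +>\<^bsub>chains_at C i t\<^esub> shift (chains C i) s t z"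
      unfolding homology_def bimodule.simps
      by (intro UN_coset_image[OF mod abelian_subgroup_boundaries[OF C] mod
            abelian_subgroup_boundaries[OF C] lin _ car[OF z]])
    show "shift (chains C i) s t z \<in> cycles C i t"
      using z lin[of i] nat[OF car[OF z]] linear_map_zero[OF mod mod lin]
      by (auto simp: cycles_def linear_map_def)
  qed
  have "homology_map Y f i t (shift (homology X i) s t A) = shift (homology Y i) s t (homology_map Y f i s A)"
    if st: "s \<le> t" and A: "A \<in> carrier (at_grade (homology X i) s)" for s t A
  proof -
    obtain z where z: "z \<in> cycles X i s" and A: "A = boundaries X i s +>\<^bsub>chains_at X i s\<^esub> z"
      using A by (auto simp: hom)
    have "f i t (shift (chains X i) s t z) = shift (chains Y i) s t (f i s z)"
      using f st car[OF z] unfolding chain_map_def bimodule_hom_def by blast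
    then show ?thesis
      by (simp add: A shift_coset[OF X st z] hmap[OF z] hmap[OF shift_cyc[OF X st z]]
          shift_coset[OF Y st fZ[OF z]])
  qed
  with lin have "bimodule_hom (homology X i) (homology Y i) (homology_map Y f i)"
    unfolding bimodule_hom_def by blast
  moreover have "bij_betw (homology_map Y f i s) (carrier (at_grade (homology X i) s))
      (carrier (at_grade (homology Y i) s))" for s
    unfolding bij_betw_def
  proof
    show "homology_map Y f i s ` carrier (at_grade (homology X i) s) = carrier (at_grade (homology Y i) s)"
    proof
      show "homology_map Y f i s ` carrier (at_grade (homology X i) s) \<subseteq> carrier (at_grade (homology Y i) s)"
        using lin[of s] by (auto simp: linear_map_def)
      show "carrier (at_grade (homology Y i) s) \<subseteq> homology_map Y f i s ` carrier (at_grade (homology X i) s)"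
      proof
        fix A assume "A \<in> carrier (at_grade (homology Y i) s)"
        then obtain c where c: "c \<in> cycles Y i s" "A = boundaries Y i s +>\<^bsub>chains_at Y i s\<^esub> c"
          by (auto simp: hom)
        obtain z where z: "z \<in> cycles X i s" "f i s z = c"
          using onto[OF c(1)] by blast
        have "A = homology_map Y f i s (boundaries X i s +>\<^bsub>chains_at X i s\<^esub> z)"
          using hmap[OF z(1)] z c by simp
        with z(1) show "A \<in> homology_map Y f i s ` carrier (at_grade (homology X i) s)"
          by (auto simp: hom)
      qed
    qed
    show "inj_on (homology_map Y f i s) (carrier (at_grade (homology X i) s))"
      unfolding hom
    proof (rule inj_onI, elim imageE)
      fix A B x y
      assume eq: "homology_map Y f i s A = homology_map Y f i s B"
        and A: "A = boundaries X i s +>\<^bsub>chains_at X i s\<^esub> x" and x: "x \<in> cycles X i s"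
        and B: "B = boundaries X i s +>\<^bsub>chains_at X i s\<^esub> y" and y: "y \<in> cycles X i s"
      have "f i s x \<oplus>\<^bsub>chains_at Y i s\<^esub> f i s y \<in> boundaries Y i s"
        using eq coset_eq_iff[OF modY subY car[OF fZ[OF x]] car[OF fZ[OF y]]]
        by (simp add: A B hmap[OF x] hmap[OF y])
      then have "f i s (x \<oplus>\<^bsub>chains_at X i s\<^esub> y) \<in> boundaries Y i s"
        using linf[of i s] car[OF x] car[OF y] by (simp add: linear_map_def)
      then have "x \<oplus>\<^bsub>chains_at X i s\<^esub> y \<in> boundaries X i s"
        by (rule reflect[OF cyc_add[OF X x y]])
      then show "A = B"
        unfolding A B using coset_eq_iff[OF modX subX car[OF x] car[OF y]] by simp
    qed
  qed
  ultimately show ?thesis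
    unfolding bimodule_iso_def by blast
qed

section \<open>Staircases of minimal grades\<close>

text \<open>A strictly smaller grade has a smaller coordinate sum, so descent inside the support
  terminates.\<close>

lemma min_grades_below:
  assumes "s \<in> supp F \<sigma>"
  shows "\<exists>x\<in>min_grades F \<sigma>. x \<le> s"
  using assms
proof (induction "fst s + snd s" arbitrary: s rule: less_induct)
  case less
  show ?case
  proof (cases "s \<in> min_grades F \<sigma>")
    case False
    then obtain t where t: "t \<in> supp F \<sigma>" "t \<le> s" "t \<noteq> s"
      using less.prems by (auto simp: min_grades_def)
    then have "fst t + snd t < fst s + snd s"
      by (cases t; cases s) auto
    from less.hyps[OF this t(1)] t(2) show ?thesis
      using order_trans by blast
  qed auto
qed

lemma min_grades_antichain:
  assumes "a \<in> min_grades F \<sigma>" "b \<in> min_grades F \<sigma>" "a \<le> b"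
  shows "a = b"
  using assms unfolding min_grades_def by blast

text \<open>Grades sharing a first coordinate are comparable, and distinct minimal grades are
  not.\<close>

lemma inj_on_fst_min_grades: "inj_on fst (min_grades F \<sigma>)"
proof (rule inj_onI)
  fix a b assume "a \<in> min_grades F \<sigma>" "b \<in> min_grades F \<sigma>" "fst a = fst b"
  then show "a = b"
    using min_grades_antichain[of a F \<sigma> b] min_grades_antichain[of b F \<sigma> a]
    by (metis less_eq_prod_def linorder_linear order_refl)
qed

lemma inj_on_snd_min_grades: "inj_on snd (min_grades F \<sigma>)"
proof (rule inj_onI)
  fix a b assume "a \<in> min_grades F \<sigma>" "b \<in> min_grades F \<sigma>" "snd a = snd b"
  then show "a = b"
    using min_grades_antichain[of a F \<sigma> b] min_grades_antichain[of b F \<sigma> a]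
    by (metis less_eq_prod_def linorder_linear order_refl)
qed

text \<open>Relative to a fixed minimal element \<open>a\<close>, every other one has a smaller first or a smaller
  second coordinate, and is determined by either.\<close>

lemma finite_min_grades: "finite (min_grades F \<sigma>)"
proof (cases "min_grades F \<sigma> = {}")
  case False
  then obtain a where a: "a \<in> min_grades F \<sigma>" by blast
  let ?A = "{b \<in> min_grades F \<sigma>. fst b < fst a}" and ?B = "{b \<in> min_grades F \<sigma>. snd b \<le> snd a}"
  have "finite ?A"
    by (rule inj_on_finite[of fst _ "{..<fst a}"])
       (use inj_on_fst_min_grades in \<open>auto intro: inj_on_subset\<close>)
  moreover have "finite ?B"
    by (rule inj_on_finite[of snd _ "{..snd a}"])
       (use inj_on_snd_min_grades in \<open>auto intro: inj_on_subset\<close>)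
  moreover have "min_grades F \<sigma> \<subseteq> ?A \<union> ?B"
  proof
    fix b assume b: "b \<in> min_grades F \<sigma>"
    show "b \<in> ?A \<union> ?B"
    proof (rule ccontr)
      assume "b \<notin> ?A \<union> ?B"
      with b have "a \<le> b" "a \<noteq> b" by (auto simp: less_eq_prod_def)
      then show False using min_grades_antichain[OF a b] by simp
    qed
  qed
  ultimately show ?thesis
    by (meson finite_UnI finite_subset)
qed auto

text \<open>The facts on sorted key lists are relative to a set on which the key is injective; here
  that set is \<open>A\<close> itself. Injectivity is what makes the sorting strict.\<close>

lemma (in linorder) sorted_key_list_of_set_inj_on:
  assumes "inj_on f A" "finite A"
  shows "set (sorted_key_list_of_set f A) = A"
    and "sorted_wrt (<) (map f (sorted_key_list_of_set f A))"
    and "length (sorted_key_list_of_set f A) = card A"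
proof -
  interpret folding_insort_key "(\<le>)" "(<)" A f
    by standard fact
  show "set (sorted_key_list_of_set f A) = A"
    and "sorted_wrt (<) (map f (sorted_key_list_of_set f A))"
    and "length (sorted_key_list_of_set f A) = card A"
    using assms(2) by simp_all
qed

lemma min_grade_sorted:
  "set (sorted_key_list_of_set fst (min_grades F \<sigma>)) = min_grades F \<sigma>"
  "sorted_wrt (<) (map fst (sorted_key_list_of_set fst (min_grades F \<sigma>)))"
  "length (sorted_key_list_of_set fst (min_grades F \<sigma>)) = card (min_grades F \<sigma>)"
  by (rule sorted_key_list_of_set_inj_on[OF inj_on_fst_min_grades finite_min_grades])+

lemma min_grade_image:
  assumes "supp F \<sigma> \<noteq> {}"
  shows "min_grade F \<sigma> ` {..last_index F \<sigma>} = min_grades F \<sigma>"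
proof -
  have "min_grades F \<sigma> \<noteq> {}"
    using assms min_grades_below by fastforce
  then have "card (min_grades F \<sigma>) > 0"
    using finite_min_grades by (simp add: card_gt_0_iff)
  \<comment> \<open>\<open>last_index\<close> is a truncated difference; positivity of the
    cardinality ensures exactly one index per minimal grade.\<close>
  then have "{..last_index F \<sigma>} = {..<length (sorted_key_list_of_set fst (min_grades F \<sigma>))}"
    by (auto simp: last_index_def min_grade_sorted)
  then show ?thesis
    using min_grade_sorted(1)[of F \<sigma>] by (auto simp: min_grade_def set_conv_nth)
qed

text \<open>Minimal grades form a staircase: as first coordinates increase, second coordinates
  decrease. Hence the \<open>k\<close>-th grade has its first coordinate bounded by that of the
  \<open>l\<close>-th and its second by that of the \<open>j\<close>-th.\<close>

lemma min_grade_between: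
  assumes "supp F \<sigma> \<noteq> {}" "j \<le> k" "k \<le> l" "l \<le> last_index F \<sigma>"
    and "min_grade F \<sigma> j \<le> s" "min_grade F \<sigma> l \<le> s"
  shows "min_grade F \<sigma> k \<le> s"
proof (cases "j = k \<or> k = l")
  case False
  let ?x = "min_grade F \<sigma>" and ?xs = "sorted_key_list_of_set fst (min_grades F \<sigma>)"
  have mem: "?x i \<in> min_grades F \<sigma>" if "i \<le> l" for i
    using min_grade_image[OF assms(1)] that assms by auto
  have "card (min_grades F \<sigma>) > 0"
    using mem[of 0] finite_min_grades by (auto simp: card_gt_0_iff)
  then have lt: "l < length ?xs"
    using assms by (simp add: last_index_def min_grade_sorted)
  have "fst (?x k) < fst (?x l)" "fst (?x j) < fst (?x k)"
    using sorted_wrt_nth_less[OF min_grade_sorted(2)[of F \<sigma>]] lt False assms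
    by (force simp: min_grade_def)+
  moreover from this(2) have "snd (?x k) \<le> snd (?x j)"
    using min_grades_antichain[OF mem[of j] mem[of k]] assms
    by (fastforce simp: less_eq_prod_def)
  ultimately show ?thesis
    using assms(5,6) by (auto simp: less_eq_prod_def)
qed (use assms in auto)

section \<open>Dyadic edges and triangles\<close>

text \<open>In terms of divisibility the condition visibly passes to both halves of an edge:
  \<open>2 ^ Suc t dvd j\<close> makes \<open>2 ^ t\<close> divide both \<open>j\<close> and
  \<open>j + 2 ^ t\<close>.\<close>

lemma dyadic_edges_iff:
  "(j, l) \<in> dyadic_edges N \<longleftrightarrow> (\<exists>t. 2 ^ t dvd j \<and> l = j + 2 ^ t \<and> l \<le> N)"
proof
  assume "(j, l) \<in> dyadic_edges N"
  then show "\<exists>t. 2 ^ t dvd j \<and> l = j + 2 ^ t \<and> l \<le> N"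
    unfolding dyadic_edges_def by auto
next
  assume "\<exists>t. 2 ^ t dvd j \<and> l = j + 2 ^ t \<and> l \<le> N"
  then obtain t s where "j = s * 2 ^ t" "l = j + 2 ^ t" "l \<le> N"
    by (metis dvdE mult.commute)
  then have "j = s * 2 ^ t \<and> l = (s + 1) * 2 ^ t \<and> (s + 1) * 2 ^ t \<le> N"
    by simp
  then show "(j, l) \<in> dyadic_edges N"
    unfolding dyadic_edges_def by blast
qed

text \<open>Oddness of \<open>s\<close> says that the left vertex \<open>(s - 1) * 2 ^ t\<close> is
  divisible by \<open>2 ^ Suc t\<close>, which makes the outer edge a dyadic edge of the next
  level.\<close>

lemma dyadic_triangles_iff:
  "(j, k, l) \<in> dyadic_triangles N \<longleftrightarrow>
    (\<exists>t. 2 ^ Suc t dvd j \<and> k = j + 2 ^ t \<and> l = j + 2 ^ Suc t \<and> l \<le> N)" (is "?L \<longleftrightarrow> ?R")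
proof
  assume ?L
  then obtain s t where st: "j = (s - 1) * 2 ^ t" "k = s * 2 ^ t" "l = (s + 1) * 2 ^ t" "odd s" "l \<le> N"
    by (auto simp: dyadic_triangles_def)
  then obtain a where "s = 2 * a + 1" by (auto elim: oddE)
  with st show ?R by (intro exI[of _ t]) (auto simp: algebra_simps)
next
  assume ?R
  then obtain t a where "j = a * 2 ^ Suc t" "k = j + 2 ^ t" "l = j + 2 ^ Suc t" "l \<le> N"
    by (metis dvdE mult.commute)
  then show ?L
    unfolding dyadic_triangles_def
    by (intro CollectI exI[of _ "2 * a + 1"] exI[of _ t]) (simp add: algebra_simps)
qed

lemma dyadic_edges_less: "(j, l) \<in> dyadic_edges N \<Longrightarrow> j < l \<and> l \<le> N"
  by (auto simp: dyadic_edges_iff)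

text \<open>The triangulated polygon bounded by the edge from \<open>j\<close> to
  \<open>j + 2 ^ t\<close> and the unit edges beneath it; it has \<open>2 ^ t - 1\<close>
  triangles.\<close>

fun dyadic_fill :: "'a set \<Rightarrow> nat \<Rightarrow> nat \<Rightarrow> ('a syz \<Rightarrow>\<^sub>0 bit)" where
  "dyadic_fill \<sigma> 0 j = 0"
| "dyadic_fill \<sigma> (Suc t) j =
    basis_elem (\<sigma>, (j, j + 2 ^ t, j + 2 ^ Suc t)) + dyadic_fill \<sigma> t j + dyadic_fill \<sigma> t (j + 2 ^ t)"

definition fill :: "('a rel \<Rightarrow>\<^sub>0 bit) \<Rightarrow> ('a syz \<Rightarrow>\<^sub>0 bit)" where
  "fill = lin_ext (\<lambda>(\<sigma>, (j, l)). dyadic_fill \<sigma> (THE t. l = j + 2 ^ t) j)"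

text \<open>Starting every path at index 0 leaves one end to track: the path between two indices is
  the sum of their unit paths, whose common initial part cancels.\<close>

definition unit_path :: "'a set \<Rightarrow> nat \<Rightarrow> ('a rel \<Rightarrow>\<^sub>0 bit)" where
  "unit_path \<sigma> j = (\<Sum>k<j. basis_elem (\<sigma>, (k, Suc k)))"

text \<open>A contraction onto index 0 that does not respect grades, since the path from 0 may pass
  through generators not yet alive. For live \<open>v\<close> the sum
  \<open>integrate (p1 v)\<close> is alive again, because the dead parts cancel.\<close>

definition integrate :: "('a gen \<Rightarrow>\<^sub>0 bit) \<Rightarrow> ('a rel \<Rightarrow>\<^sub>0 bit)" where
  "integrate = lin_ext (\<lambda>(\<sigma>, j). unit_path \<sigma> j)"

lemma additive_fill [simp]: "additive fill"
  and additive_integrate [simp]: "additive integrate"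
  and additive_p1 [simp]: "additive p1"
  and additive_p2 [simp]: "additive p2"
  and additive_f0 [simp]: "additive (f0 y)"
  and additive_f1 [simp]: "additive (f1 F y)"
  and additive_h0 [simp]: "additive (h0 F y)"
  by (simp_all add: fill_def integrate_def p1_def p2_def f0_def f1_def h0_def)

lemmas additive_linear_maps = additive_fill additive_integrate additive_p1 additive_p2
  additive_f0 additive_f1 additive_h0
lemmas linear_maps_add [simp] = additive_linear_maps[THEN additive.add]
lemmas linear_maps_zero [simp] = additive_linear_maps[THEN additive.zero]
lemmas linear_maps_sum = additive_linear_maps[THEN additive.sum]

lemma fill_edge [simp]: "fill (basis_elem (\<sigma>, (j, j + 2 ^ t))) = dyadic_fill \<sigma> t j"
proof -
  have "(THE u. j + 2 ^ t = j + 2 ^ u) = t" by (rule the_equality) auto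
  then show ?thesis by (simp add: fill_def)
qed

lemma p1_edge [simp]: "p1 (basis_elem (\<sigma>, (j, l))) = basis_elem (\<sigma>, j) + basis_elem (\<sigma>, l)"
  by (simp add: p1_def)

lemma p2_triangle [simp]: "p2 (basis_elem (\<sigma>, (j, k, l))) =
    basis_elem (\<sigma>, (j, k)) + basis_elem (\<sigma>, (k, l)) + basis_elem (\<sigma>, (j, l))"
  by (simp add: p2_def)

lemma integrate_gen [simp]: "integrate (basis_elem (\<sigma>, j)) = unit_path \<sigma> j"
  by (simp add: integrate_def)

lemma p1_p2 [simp]: "p1 (p2 w) = 0"
proof (rule additive_eq_on_keys_span[of w UNIV, where g = "\<lambda>_. 0"])
  show "p1 (p2 (basis_elem b)) = 0" for b :: "'a syz"
    by (cases b) (simp add: add_ac)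
qed (simp_all add: additive_def)

text \<open>The new triangle trades the edge for its two halves. These cancel against the edges
  produced by the recursive calls, and the unit path to the midpoint occurs twice.\<close>

lemma p2_dyadic_fill:
  "p2 (dyadic_fill \<sigma> t j) = basis_elem (\<sigma>, (j, j + 2 ^ t)) + unit_path \<sigma> j + unit_path \<sigma> (j + 2 ^ t)"
proof (induction t arbitrary: j)
  case 0
  show ?case by (simp add: unit_path_def add_ac)
next
  case (Suc t)
  show ?case by (simp add: Suc add_ac mult_2)
qed

section \<open>Connecting paths\<close>

text \<open>Telescoping: an interior vertex belongs to two consecutive edges and cancels.\<close>

lemma sum_list_path_boundary:
  "xs \<noteq> [] \<Longrightarrow> p1 (\<Sum>e\<leftarrow>zip xs (tl xs). basis_elem (\<sigma>, e)) = basis_elem (\<sigma>, hd xs) + basis_elem (\<sigma>, last xs)"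
proof (induction xs rule: induct_list012)
  case (3 a b xs)
  then show ?case by (simp add: add_ac)
qed simp_all

text \<open>Indices increase along edges, so a path stays between its ends. Together with
  \<open>min_grade_between\<close> this keeps a connecting path alive wherever both of its ends
  are.\<close>

lemma monotone_path_edges:
  assumes "successively (\<lambda>a b. (a, b) \<in> dyadic_edges N) xs" "(a, b) \<in> set (zip xs (tl xs))"
  shows "(a, b) \<in> dyadic_edges N \<and> hd xs \<le> a \<and> b \<le> last xs"
  using assms
proof (induction xs rule: induct_list012)
  case (3 u v xs)
  have le: "v \<le> last (v # xs)"
    using 3(4)
  proof -
    have "successively (\<lambda>a b. (a, b) \<in> dyadic_edges N) ys \<Longrightarrow> ys \<noteq> [] \<Longrightarrow> hd ys \<le> last ys" for ys
      by (induction ys rule: induct_list012) (use dyadic_edges_less in fastforce)+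
    from this[of "v # xs"] 3 show ?thesis by simp
  qed
  have uv: "u < v"
    using 3 dyadic_edges_less by auto
  show ?case
  proof (cases "(a, b) \<in> set (zip (v # xs) xs)")
    case True
    with 3 uv show ?thesis by auto
  next
    case False
    with 3 le show ?thesis by auto
  qed
qed auto

text \<open>\<open>ARG_MIN\<close> yields a path once some path exists; unit steps, the dyadic edges
  of exponent 0, provide one.\<close>

lemma monotone_path_shortest:
  assumes "j \<le> l" "l \<le> N"
  shows "monotone_path N j l (shortest_path N j l)"
  unfolding shortest_path_def
proof (rule arg_min_natI)
  have "successively (\<lambda>a b. (a, b) \<in> dyadic_edges N) [j..<Suc l]"
    using assms(1,2)
  proof (induction rule: dec_induct)
    case base
    then show ?case by simp
  next
    case (step n)
    have "(n, Suc n) \<in> dyadic_edges N"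
      unfolding dyadic_edges_iff by (rule exI[of _ 0]) (use step in auto)
    with step show ?case
      by (simp add: successively_append_iff)
  qed
  then show "monotone_path N j l [j..<Suc l]"
    using assms by (auto simp: monotone_path_def hd_append)
qed

lemma p1_connecting_path:
  assumes "j \<le> last_index F \<sigma>" "l \<le> last_index F \<sigma>"
  shows "p1 (connecting_path F \<sigma> j l) = basis_elem (\<sigma>, j) + basis_elem (\<sigma>, l)"
proof -
  have "monotone_path (last_index F \<sigma>) (min j l) (max j l) (shortest_path (last_index F \<sigma>) (min j l) (max j l))"
    by (rule monotone_path_shortest) (use assms in auto)
  then show ?thesis
    by (auto simp: connecting_path_def Let_def sum_list_path_boundary monotone_path_def min_def max_def add_ac)
qed

section \<open>Exactness at a fixed grade\<close>

locale log_path =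
  fixes K :: "'a set set"
    and F :: "grade \<Rightarrow> 'a set set"
    and y :: "'a set \<Rightarrow> nat \<Rightarrow> 'a set \<Rightarrow> nat"
  assumes bifiltration: "simplicial_bifiltration K F"
    and choice: "facet_choice K F y"
begin

definition gens :: "int \<Rightarrow> grade \<Rightarrow> 'a gen set" where
  "gens i s = {(\<sigma>, j). \<sigma> \<in> simplices K i \<and> j \<le> last_index F \<sigma> \<and> min_grade F \<sigma> j \<le> s}"

definition rels :: "int \<Rightarrow> grade \<Rightarrow> 'a rel set" where
  "rels i s = {(\<sigma>, (j, l)). \<sigma> \<in> simplices K i \<and> (j, l) \<in> dyadic_edges (last_index F \<sigma>) \<and>
     min_grade F \<sigma> j \<le> s \<and> min_grade F \<sigma> l \<le> s}"

definition syzs :: "int \<Rightarrow> grade \<Rightarrow> 'a syz set" where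
  "syzs i s = {(\<sigma>, (j, k, l)). \<sigma> \<in> simplices K i \<and> (j, k, l) \<in> dyadic_triangles (last_index F \<sigma>) \<and>
     min_grade F \<sigma> j \<le> s \<and> min_grade F \<sigma> l \<le> s}"

abbreviation "G i s \<equiv> keys_span (gens i s)"
abbreviation "R i s \<equiv> keys_span (rels i s)"
abbreviation "S i s \<equiv> keys_span (syzs i s)"
abbreviation "C i s \<equiv> keys_span (live_at (simplices K i) (min_grades F) s)"

lemma supp_nonempty: "\<sigma> \<in> simplices K i \<Longrightarrow> supp F \<sigma> \<noteq> {}"
  using bifiltration unfolding simplicial_bifiltration_def simplices_def supp_def by blast

lemma between:
  assumes "\<sigma> \<in> simplices K i" "j \<le> k" "k \<le> l" "l \<le> last_index F \<sigma>"
    and "min_grade F \<sigma> j \<le> s" "min_grade F \<sigma> l \<le> s"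
  shows "min_grade F \<sigma> k \<le> s"
  by (rule min_grade_between[OF supp_nonempty[OF assms(1)] assms(2-)])

lemma finite_simplex: "\<sigma> \<in> simplices K i \<Longrightarrow> finite \<sigma> \<and> \<sigma> \<noteq> {}"
  using bifiltration by (auto simp: simplicial_bifiltration_def simplicial_complex_def simplices_def)

lemma finite_faces: "\<sigma> \<in> simplices K i \<Longrightarrow> finite (faces d \<sigma>)"
  using finite_simplex by (auto simp: faces_def intro: finite_subset[of _ "Pow \<sigma>"])

lemma face_in_simplices: "\<sigma> \<in> simplices K i \<Longrightarrow> \<tau> \<in> faces d \<sigma> \<Longrightarrow> \<tau> \<in> simplices K (i - int d)"
  using bifiltration
  by (auto simp: simplicial_bifiltration_def simplicial_complex_def simplices_def faces_def)

lemma facet_in_simplices: "\<sigma> \<in> simplices K i \<Longrightarrow> \<tau> \<in> facets \<sigma> \<Longrightarrow> \<tau> \<in> simplices K (i - 1)"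
  using face_in_simplices[of \<sigma> i \<tau> 1] by simp

lemma choice_gen:
  assumes "(\<sigma>, j) \<in> gens i s" "\<tau> \<in> facets \<sigma>"
  shows "(\<tau>, y \<sigma> j \<tau>) \<in> gens (i - 1) s"
proof -
  have "\<sigma> \<in> K" "j \<le> last_index F \<sigma>"
    using assms(1) by (auto simp: gens_def simplices_def)
  then have "y \<sigma> j \<tau> \<le> last_index F \<tau>" "min_grade F \<tau> (y \<sigma> j \<tau>) \<le> min_grade F \<sigma> j"
    using choice assms(2) unfolding facet_choice_def by blast+
  then show ?thesis
    using assms facet_in_simplices by (auto simp: gens_def)
qed

lemma edge_ends:
  assumes "(\<sigma>, (j, l)) \<in> rels i s"
  shows "(\<sigma>, j) \<in> gens i s" "(\<sigma>, l) \<in> gens i s"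
  using assms dyadic_edges_less by (fastforce simp: rels_def gens_def)+

lemma p1_in: "v \<in> R i s \<Longrightarrow> p1 v \<in> G i s"
  unfolding p1_def by (erule lin_ext_in_keys_span) (auto intro!: keys_span_add intro: edge_ends)

lemma triangle_edges:
  assumes "(\<sigma>, (j, k, l)) \<in> syzs i s"
  shows "(\<sigma>, (j, k)) \<in> rels i s" "(\<sigma>, (k, l)) \<in> rels i s" "(\<sigma>, (j, l)) \<in> rels i s"
proof -
  obtain t where t: "2 ^ Suc t dvd j" "k = j + 2 ^ t" "l = j + 2 ^ Suc t" "l \<le> last_index F \<sigma>"
    and s: "\<sigma> \<in> simplices K i" "min_grade F \<sigma> j \<le> s" "min_grade F \<sigma> l \<le> s"
    using assms by (auto simp: syzs_def dyadic_triangles_iff)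
  have k: "min_grade F \<sigma> k \<le> s"
    by (rule between[OF s(1) _ _ t(4) s(2,3)]) (use t in auto)
  have d: "2 ^ t dvd j"
    using t(1) by (rule power_le_dvd) simp
  have "2 ^ t dvd k" "l = k + 2 ^ t" "k \<le> l"
    using d t by simp_all
  then show "(\<sigma>, (j, k)) \<in> rels i s" "(\<sigma>, (k, l)) \<in> rels i s" "(\<sigma>, (j, l)) \<in> rels i s"
    unfolding rels_def dyadic_edges_iff using d t s k by (auto intro: exI[of _ t] exI[of _ "Suc t"])
qed

lemma p2_in: "w \<in> S i s \<Longrightarrow> p2 w \<in> R i s"
  unfolding p2_def by (erule lin_ext_in_keys_span) (auto intro!: keys_span_add intro: triangle_edges)

text \<open>The midpoint of a live edge is alive by \<open>between\<close>, so both halves satisfy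
  the hypotheses one level down.\<close>

lemma dyadic_fill_in:
  assumes "\<sigma> \<in> simplices K i" "2 ^ t dvd j" "j + 2 ^ t \<le> last_index F \<sigma>"
    "min_grade F \<sigma> j \<le> s" "min_grade F \<sigma> (j + 2 ^ t) \<le> s"
  shows "dyadic_fill \<sigma> t j \<in> S i s"
  using assms
proof (induction t arbitrary: j)
  case (Suc t)
  have mid: "min_grade F \<sigma> (j + 2 ^ t) \<le> s"
    by (rule between[OF Suc.prems(1) _ _ Suc.prems(3-5)]) auto
  have d: "2 ^ t dvd j"
    using Suc.prems(2) by (rule power_le_dvd) simp
  have "(j, j + 2 ^ t, j + 2 ^ Suc t) \<in> dyadic_triangles (last_index F \<sigma>)"
    using Suc.prems by (auto simp: dyadic_triangles_iff)
  then have "(\<sigma>, (j, j + 2 ^ t, j + 2 ^ Suc t)) \<in> syzs i s"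
    using Suc.prems by (simp add: syzs_def)
  moreover have "dyadic_fill \<sigma> t j \<in> S i s"
    by (rule Suc.IH) (use Suc.prems mid d in auto)
  moreover have "dyadic_fill \<sigma> t (j + 2 ^ t) \<in> S i s"
    by (rule Suc.IH) (use Suc.prems mid d in \<open>auto simp: add.assoc mult_2\<close>)
  ultimately show ?case by simp
qed simp

lemma fill_in:
  assumes "v \<in> R i s" shows "fill v \<in> S i s"
proof (rule additive_in_keys_span[OF assms additive_fill])
  fix b assume b: "b \<in> rels i s"
  obtain \<sigma> j l where jl: "b = (\<sigma>, (j, l))" by (cases b) auto
  then obtain t where "2 ^ t dvd j" "l = j + 2 ^ t" "l \<le> last_index F \<sigma>"
    using b by (auto simp: rels_def dyadic_edges_iff)
  then show "fill (basis_elem b) \<in> S i s"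
    using b jl by (auto simp: rels_def intro!: dyadic_fill_in)
qed

text \<open>Long edges correspond to the triangles splitting them into halves, and \<open>fill\<close> replaces an
  edge by its unit path through these triangles. So \<open>fill\<close> and \<open>integrate\<close> contract the complex
  \<open>G \<leftarrow> R \<leftarrow> S\<close> at \<open>R\<close> and \<open>S\<close>.\<close>

lemma p2_fill:
  assumes "v \<in> R i s" shows "p2 (fill v) = v + integrate (p1 v)"
proof (rule additive_eq_on_keys_span[OF assms])
  fix b assume b: "b \<in> rels i s"
  obtain \<sigma> j l where jl: "b = (\<sigma>, (j, l))" by (cases b) auto
  then obtain t where "l = j + 2 ^ t"
    using b by (auto simp: rels_def dyadic_edges_iff)
  then show "p2 (fill (basis_elem b)) = basis_elem b + integrate (p1 (basis_elem b))"
    by (simp add: jl p2_dyadic_fill add_ac)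
qed (simp_all add: additive_def add_ac)

text \<open>By the recursion, filling the outer edge of a triangle gives the triangle plus the
  fillings of its halves, and the latter cancel against the fillings of the two short edges.\<close>

lemma fill_p2:
  assumes "w \<in> S i s" shows "fill (p2 w) = w"
proof (rule additive_eq_on_keys_span[OF assms])
  fix b assume b: "b \<in> syzs i s"
  obtain \<sigma> j k l where jl: "b = (\<sigma>, (j, k, l))" by (cases b) auto
  then obtain t where t: "k = j + 2 ^ t" "l = j + 2 ^ Suc t"
    using b by (auto simp: syzs_def dyadic_triangles_iff)
  have kl: "l = k + 2 ^ t" using t by simp
  \<comment> \<open>\<open>fill_edge\<close> needs the right end written as the left end plus a
    power of two, so the three edges are brought to that shape.\<close>
  have "fill (p2 (basis_elem b)) = fill (basis_elem (\<sigma>, (j, j + 2 ^ t)))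
      + fill (basis_elem (\<sigma>, (k, k + 2 ^ t))) + fill (basis_elem (\<sigma>, (j, j + 2 ^ Suc t)))"
    using t(2) by (simp add: jl flip: kl t(1))
  also have "\<dots> = basis_elem b"
    by (simp only: fill_edge dyadic_fill.simps) (simp add: jl t add_ac)
  finally show "fill (p2 (basis_elem b)) = basis_elem b" .
qed (simp_all add: additive_def add_ac)

lemma connecting_path_in:
  assumes "(\<sigma>, j) \<in> gens i s" "(\<sigma>, l) \<in> gens i s"
  shows "connecting_path F \<sigma> j l \<in> R i s"
proof -
  define a b N where "a = min j l" and "b = max j l" and "N = last_index F \<sigma>"
  have \<sigma>: "\<sigma> \<in> simplices K i" and ab: "a \<le> b" "b \<le> N" "min_grade F \<sigma> a \<le> s" "min_grade F \<sigma> b \<le> s"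
    using assms by (auto simp: gens_def a_def b_def N_def min_def max_def)
  let ?xs = "shortest_path N a b"
  have mp: "monotone_path N a b ?xs"
    by (rule monotone_path_shortest[OF ab(1,2)])
  have "(\<sigma>, e) \<in> rels i s" if "e \<in> set (zip ?xs (tl ?xs))" for e
  proof -
    obtain c d where cd: "e = (c, d)" by (cases e)
    then have e: "(c, d) \<in> dyadic_edges N" "a \<le> c" "d \<le> b"
      using monotone_path_edges[of N ?xs c d] mp that by (auto simp: monotone_path_def)
    moreover have "c < d" "d \<le> N"
      using dyadic_edges_less[OF e(1)] by auto
    ultimately have "min_grade F \<sigma> c \<le> s" "min_grade F \<sigma> d \<le> s"
      using ab by (auto intro: between[OF \<sigma> _ _ _ ab(3,4)] simp: N_def)
    with e \<sigma> cd show ?thesis by (simp add: rels_def N_def)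
  qed
  then show ?thesis
    unfolding connecting_path_def Let_def a_def[symmetric] b_def[symmetric] N_def[symmetric]
    by (intro keys_span_sum_list) auto
qed

section \<open>The lifted maps on generators and relations\<close>

lemma f0_gen: "f0 y (basis_elem (\<sigma>, j)) = (\<Sum>\<tau>\<in>facets \<sigma>. basis_elem (\<tau>, y \<sigma> j \<tau>))"
  by (simp add: f0_def)

lemma f1_rel: "f1 F y (basis_elem (\<sigma>, (j, l))) = (\<Sum>\<tau>\<in>facets \<sigma>. connecting_path F \<tau> (y \<sigma> j \<tau>) (y \<sigma> l \<tau>))"
  by (simp add: f1_def)

lemma f0_in: "u \<in> G i s \<Longrightarrow> f0 y u \<in> G (i - 1) s"
  unfolding f0_def
  by (erule lin_ext_in_keys_span) (auto intro!: keys_span_sum choice_gen)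

lemma f1_in: "v \<in> R i s \<Longrightarrow> f1 F y v \<in> R (i - 1) s"
  unfolding f1_def
  by (erule lin_ext_in_keys_span)
     (auto intro!: keys_span_sum connecting_path_in choice_gen intro: edge_ends)

text \<open>\<open>p1\<close> sees a path only through its ends, and the paths in \<open>f1\<close>
  end at the generators chosen by \<open>f0\<close>.\<close>

lemma p1_f1:
  assumes "v \<in> R i s" shows "p1 (f1 F y v) = f0 y (p1 v)"
proof (rule additive_eq_on_keys_span[OF assms])
  fix b assume b: "b \<in> rels i s"
  obtain \<sigma> j l where jl: "b = (\<sigma>, (j, l))" by (cases b) auto
  have "p1 (connecting_path F \<tau> (y \<sigma> j \<tau>) (y \<sigma> l \<tau>)) = basis_elem (\<tau>, y \<sigma> j \<tau>) + basis_elem (\<tau>, y \<sigma> l \<tau>)"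
    if "\<tau> \<in> facets \<sigma>" for \<tau>
    by (rule p1_connecting_path)
       (use choice_gen[OF edge_ends(1) that] choice_gen[OF edge_ends(2) that] b jl in \<open>auto simp: gens_def\<close>)
  then show "p1 (f1 F y (basis_elem b)) = f0 y (p1 (basis_elem b))"
    by (simp add: jl f1_rel f0_gen linear_maps_sum sum.distrib)
qed (simp_all add: additive_def)

end

section \<open>Faces and the augmentation\<close>

text \<open>An intermediate face adds one of the two vertices missing from
  \<open>\<tau>\<close>.\<close>

lemma facets_between:
  assumes "finite \<sigma>" "\<tau> \<in> faces 2 \<sigma>"
  obtains \<rho>1 \<rho>2 where "\<rho>1 \<noteq> \<rho>2" "{\<rho> \<in> facets \<sigma>. \<tau> \<in> facets \<rho>} = {\<rho>1, \<rho>2}"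
proof -
  have \<tau>: "\<tau> \<noteq> {}" "\<tau> \<subseteq> \<sigma>" "card \<tau> + 2 = card \<sigma>" "finite \<tau>"
    using assms finite_subset by (auto simp: faces_def)
  then have "card (\<sigma> - \<tau>) = 2"
    by (simp add: card_Diff_subset)
  then obtain a b where ab: "\<sigma> - \<tau> = {a, b}" "a \<noteq> b"
    by (auto simp: card_2_iff)
  have "{\<rho> \<in> facets \<sigma>. \<tau> \<in> facets \<rho>} = {insert a \<tau>, insert b \<tau>}"
  proof (intro subset_antisym subsetI)
    fix \<rho> assume "\<rho> \<in> {\<rho> \<in> facets \<sigma>. \<tau> \<in> facets \<rho>}"
    then have \<rho>: "\<rho> \<subseteq> \<sigma>" "\<tau> \<subseteq> \<rho>" "card \<rho> = card \<tau> + 1"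
      by (auto simp: faces_def)
    then have "card (\<rho> - \<tau>) = 1"
      using \<tau>(4) by (simp add: card_Diff_subset)
    then obtain c where c: "\<rho> - \<tau> = {c}"
      by (auto simp: card_1_singleton_iff)
    then have "\<rho> = insert c \<tau>" "c \<in> \<sigma> - \<tau>"
      using \<rho> by blast+
    then show "\<rho> \<in> {insert a \<tau>, insert b \<tau>}"
      by (auto simp: ab(1))
  next
    fix \<rho> assume "\<rho> \<in> {insert a \<tau>, insert b \<tau>}"
    moreover have "a \<in> \<sigma>" "b \<in> \<sigma>" "a \<notin> \<tau>" "b \<notin> \<tau>"
      using ab by auto
    ultimately show "\<rho> \<in> {\<rho> \<in> facets \<sigma>. \<tau> \<in> facets \<rho>}"
      using \<tau> by (auto simp: faces_def)
  qed
  moreover have "insert a \<tau> \<noteq> insert b \<tau>"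
    using ab by auto
  ultimately show thesis
    using that by metis
qed

lemma facet_of_facet:
  assumes "\<rho> \<in> facets \<sigma>"
  shows "{\<tau> \<in> faces 2 \<sigma>. \<tau> \<in> facets \<rho>} = facets \<rho>"
  using assms by (auto simp: faces_def)

text \<open>The canonical surjection \<alpha>: all generators of a simplex go to the same nonzero
  element of its upset module, so only the simplex is kept.\<close>

definition augmentation :: "('a gen \<Rightarrow>\<^sub>0 bit) \<Rightarrow> ('a set \<Rightarrow>\<^sub>0 bit)" where
  "augmentation = lin_ext (\<lambda>(\<sigma>, j). basis_elem \<sigma>)"

definition simplicial_boundary :: "('a set \<Rightarrow>\<^sub>0 bit) \<Rightarrow> ('a set \<Rightarrow>\<^sub>0 bit)" where
  "simplicial_boundary = lin_ext (\<lambda>\<sigma>. \<Sum>\<tau>\<in>facets \<sigma>. basis_elem \<tau>)"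

lemma additive_augmentation [simp]: "additive augmentation"
  and additive_simplicial_boundary [simp]: "additive simplicial_boundary"
  by (simp_all add: augmentation_def simplicial_boundary_def)

lemmas augmentation_add [simp] = additive_augmentation[THEN additive.add]
  and simplicial_boundary_add [simp] = additive_simplicial_boundary[THEN additive.add]
  and augmentation_zero [simp] = additive_augmentation[THEN additive.zero]
  and simplicial_boundary_zero [simp] = additive_simplicial_boundary[THEN additive.zero]

lemma augmentation_gen [simp]: "augmentation (basis_elem (\<sigma>, j)) = basis_elem \<sigma>"
  by (simp add: augmentation_def)

lemma augmentation_p1 [simp]: "augmentation (p1 v) = 0"
proof (rule additive_eq_on_keys_span[of v UNIV, where g = "\<lambda>_. 0"])
  show "augmentation (p1 (basis_elem b)) = 0" for b :: "'a rel"
    by (cases b) simp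
qed (simp_all add: additive_def)

text \<open>The choice \<open>y\<close> affects only indices, which the augmentation
  forgets.\<close>

lemma augmentation_f0: "augmentation (f0 y u) = simplicial_boundary (augmentation u)"
proof (rule additive_eq_on_keys_span[of u UNIV])
  show "augmentation (f0 y (basis_elem b)) = simplicial_boundary (augmentation (basis_elem b))" for b :: "'a gen"
    by (cases b) (simp add: f0_def simplicial_boundary_def additive.sum[OF additive_augmentation])
qed (simp_all add: additive_def)

text \<open>Naturality is automatic: the structure maps are identities and \<open>f\<close> does not
  depend on the grade.\<close>

lemma bimodule_hom_additive:
  assumes "additive f"
    and "\<And>s v. v \<in> keys_span (live_at B A s) \<Longrightarrow> f v \<in> keys_span (live_at B' A' s)"
  shows "bimodule_hom (upset_sum B A) (upset_sum B' A') (\<lambda>s. f)"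
proof -
  note mod = bipersistence_moduleD(1)[OF bipersistence_module_upset_sum]
  have "linear_map (at_grade (upset_sum B A) s) (at_grade (upset_sum B' A') s) f" for s
    by (rule linear_mapI[OF mod mod]) (use assms in \<open>auto simp: additive_def\<close>)
  then show ?thesis
    by (simp add: bimodule_hom_def)
qed

context log_path
begin

text \<open>The two intermediate facets may pick the same generator. Then the set collapses to a
  singleton while the sum over the facets cancels, in agreement with a trivial path; recording set
  and sum through the same \<open>c\<close> and \<open>d\<close> covers both cases.\<close>

lemma contributing_gens:
  assumes "(\<sigma>, j) \<in> gens i s" "\<tau> \<in> faces 2 \<sigma>"
  shows "\<exists>c d. contributing y \<sigma> j \<tau> = {c, d} \<and> (\<tau>, c) \<in> gens (i - 2) s \<and> (\<tau>, d) \<in> gens (i - 2) s \<and>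
    (\<Sum>\<rho> | \<rho> \<in> facets \<sigma> \<and> \<tau> \<in> facets \<rho>. basis_elem (\<tau>, y \<rho> (y \<sigma> j \<rho>) \<tau>)) = basis_elem (\<tau>, c) + basis_elem (\<tau>, d)"
proof -
  let ?c = "\<lambda>\<rho>. y \<rho> (y \<sigma> j \<rho>) \<tau>"
  have "finite \<sigma>"
    using assms finite_simplex by (auto simp: gens_def)
  obtain \<rho>1 \<rho>2 where \<rho>: "\<rho>1 \<noteq> \<rho>2" "{\<rho> \<in> facets \<sigma>. \<tau> \<in> facets \<rho>} = {\<rho>1, \<rho>2}"
    by (rule facets_between[OF \<open>finite \<sigma>\<close> assms(2)])
  have c: "(\<tau>, ?c \<rho>) \<in> gens (i - 2) s" if "\<rho> \<in> {\<rho> \<in> facets \<sigma>. \<tau> \<in> facets \<rho>}" for \<rho>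
    using choice_gen[OF choice_gen[OF assms(1)], of \<rho> \<tau>] that by simp
  have "contributing y \<sigma> j \<tau> = ?c ` {\<rho> \<in> facets \<sigma>. \<tau> \<in> facets \<rho>}"
    unfolding contributing_def by blast
  then have "contributing y \<sigma> j \<tau> = {?c \<rho>1, ?c \<rho>2}"
    by (simp only: \<rho>(2) image_insert image_empty)
  moreover have "(\<tau>, ?c \<rho>1) \<in> gens (i - 2) s" "(\<tau>, ?c \<rho>2) \<in> gens (i - 2) s"
    by (rule c, simp only: \<rho>(2), simp)+
  moreover have "(\<Sum>\<rho> | \<rho> \<in> facets \<sigma> \<and> \<tau> \<in> facets \<rho>. basis_elem (\<tau>, ?c \<rho>)) =
      basis_elem (\<tau>, ?c \<rho>1) + basis_elem (\<tau>, ?c \<rho>2)"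
    using \<rho>(1) by (simp only: \<rho>(2)) simp
  ultimately show ?thesis
    by blast
qed

lemma h0_gen: "h0 F y (basis_elem (\<sigma>, j)) = (\<Sum>\<tau>\<in>faces 2 \<sigma>.
     connecting_path F \<tau> (Min (contributing y \<sigma> j \<tau>)) (Max (contributing y \<sigma> j \<tau>)))"
  by (simp add: h0_def)

lemma h0_in:
  assumes "u \<in> G i s" shows "h0 F y u \<in> R (i - 2) s"
proof (rule additive_in_keys_span[OF assms additive_h0])
  fix b assume b: "b \<in> gens i s"
  obtain \<sigma> j where j: "b = (\<sigma>, j)" by (cases b)
  have "connecting_path F \<tau> (Min (contributing y \<sigma> j \<tau>)) (Max (contributing y \<sigma> j \<tau>)) \<in> R (i - 2) s"
    if \<tau>: "\<tau> \<in> faces 2 \<sigma>" for \<tau>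
    using contributing_gens[OF b[unfolded j] \<tau>]
    by (auto intro!: connecting_path_in simp: min_def max_def)
  then show "h0 F y (basis_elem b) \<in> R (i - 2) s"
    unfolding j h0_gen by (rule keys_span_sum)
qed

text \<open>Both sides sum over chains of faces \<tau> in \<rho> in \<sigma>. Applying
  \<open>f0\<close> twice runs over \<rho> first; \<open>h0\<close> runs over \<tau> first, and the
  two faces \<rho> supply the ends of its path.\<close>

lemma p1_h0:
  assumes "u \<in> G i s" shows "p1 (h0 F y u) = f0 y (f0 y u)"
proof (rule additive_eq_on_keys_span[OF assms])
  fix b assume b: "b \<in> gens i s"
  obtain \<sigma> j where j: "b = (\<sigma>, j)" by (cases b)
  have \<sigma>: "\<sigma> \<in> simplices K i"
    using b j by (simp add: gens_def)
  let ?b = "\<lambda>\<rho> \<tau>. basis_elem (\<tau>, y \<rho> (y \<sigma> j \<rho>) \<tau>)"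
  have "p1 (h0 F y (basis_elem b)) = (\<Sum>\<tau>\<in>faces 2 \<sigma>. \<Sum>\<rho> | \<rho> \<in> facets \<sigma> \<and> \<tau> \<in> facets \<rho>. ?b \<rho> \<tau>)"
    unfolding j h0_gen linear_maps_sum
  proof (rule sum.cong[OF refl])
    fix \<tau> assume \<tau>: "\<tau> \<in> faces 2 \<sigma>"
    obtain c d where cd: "contributing y \<sigma> j \<tau> = {c, d}" "(\<tau>, c) \<in> gens (i - 2) s" "(\<tau>, d) \<in> gens (i - 2) s"
      "(\<Sum>\<rho> | \<rho> \<in> facets \<sigma> \<and> \<tau> \<in> facets \<rho>. ?b \<rho> \<tau>) = basis_elem (\<tau>, c) + basis_elem (\<tau>, d)"
      using contributing_gens[OF b[unfolded j] \<tau>] by blast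
    then have "c \<le> last_index F \<tau>" "d \<le> last_index F \<tau>"
      by (simp_all add: gens_def)
    then have "p1 (connecting_path F \<tau> (min c d) (max c d)) = basis_elem (\<tau>, c) + basis_elem (\<tau>, d)"
      by (subst p1_connecting_path) (auto simp: min_def max_def add_ac)
    then show "p1 (connecting_path F \<tau> (Min (contributing y \<sigma> j \<tau>)) (Max (contributing y \<sigma> j \<tau>))) =
        (\<Sum>\<rho> | \<rho> \<in> facets \<sigma> \<and> \<tau> \<in> facets \<rho>. ?b \<rho> \<tau>)"
      unfolding cd(1) cd(4) by simp
  qed
  also have "\<dots> = (\<Sum>\<rho>\<in>facets \<sigma>. \<Sum>\<tau> | \<tau> \<in> faces 2 \<sigma> \<and> \<tau> \<in> facets \<rho>. ?b \<rho> \<tau>)"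
    by (rule sum.swap_restrict[symmetric]) (rule finite_faces[OF \<sigma>])+
  also have "\<dots> = (\<Sum>\<rho>\<in>facets \<sigma>. \<Sum>\<tau>\<in>facets \<rho>. ?b \<rho> \<tau>)"
    by (rule sum.cong[OF refl], rule sum.cong[OF facet_of_facet refl])
  also have "\<dots> = f0 y (f0 y (basis_elem b))"
    by (simp add: j f0_gen linear_maps_sum)
  finally show "p1 (h0 F y (basis_elem b)) = f0 y (f0 y (basis_elem b))" .
qed (simp_all add: additive_def)

section \<open>Surjectivity and exactness of the augmentation\<close>

lemma min_grade_in: "\<sigma> \<in> simplices K i \<Longrightarrow> j \<le> last_index F \<sigma> \<Longrightarrow> min_grade F \<sigma> j \<in> min_grades F \<sigma>"
  using min_grade_image[OF supp_nonempty] by blast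

lemma gens_live:
  "(\<sigma>, j) \<in> gens i s \<Longrightarrow> \<sigma> \<in> live_at (simplices K i) (min_grades F) s"
  unfolding gens_def live_at_def using min_grade_in[of \<sigma> i j] by blast

lemma augmentation_in: "u \<in> G i s \<Longrightarrow> augmentation u \<in> C i s"
  unfolding augmentation_def
  by (erule lin_ext_in_keys_span) (auto intro: gens_live)

lemma live_simplex_gen:
  assumes "\<sigma> \<in> live_at (simplices K i) (min_grades F) s"
  shows "\<exists>j. (\<sigma>, j) \<in> gens i s"
proof -
  obtain x where x: "\<sigma> \<in> simplices K i" "x \<in> min_grades F \<sigma>" "x \<le> s"
    using assms unfolding live_at_def by blast
  then obtain j where "j \<le> last_index F \<sigma>" "x = min_grade F \<sigma> j"
    using min_grade_image[OF supp_nonempty[OF x(1)]] by (metis atMost_iff imageE)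
  with x show ?thesis
    by (auto simp: gens_def)
qed

lemma augmentation_onto:
  assumes "c \<in> C i s" obtains u where "u \<in> G i s" "augmentation u = c"
proof -
  have "\<exists>u\<in>G i s. augmentation u = c"
    using assms
  proof (induction rule: keys_span_induct)
    case zero
    show ?case by (rule bexI[of _ 0]) simp_all
  next
    case (basis \<sigma>)
    with live_simplex_gen obtain j where "(\<sigma>, j) \<in> gens i s" by blast
    then show ?case by (intro bexI[of _ "basis_elem (\<sigma>, j)"]) simp_all
  next
    case (add c d)
    then obtain u v where "u \<in> G i s" "v \<in> G i s" "augmentation u = c" "augmentation v = d" by blast
    then show ?case by (intro bexI[of _ "u + v"]) simp_all
  qed
  then show thesis using that by blast
qed

text \<open>Joining each generator to a live base generator \<open>a \<sigma>\<close> of its simplex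
  contracts the kernel. Index 0 cannot serve as the base, since it may not be alive at
  \<open>s\<close>. The contraction thus varies with the grade, which is harmless because exactness
  concerns one grade at a time.\<close>

lemma augmentation_exact:
  assumes "u \<in> G i s" "augmentation u = 0" obtains v where "v \<in> R i s" "p1 v = u"
proof -
  define a where "a \<sigma> = (SOME j. (\<sigma>, j) \<in> gens i s)" for \<sigma>
  define \<iota> where "\<iota> = lin_ext (\<lambda>\<sigma>. basis_elem (\<sigma>, a \<sigma>))"
  define \<kappa> where "\<kappa> = lin_ext (\<lambda>(\<sigma>, j). connecting_path F \<sigma> j (a \<sigma>))"
  have add: "additive \<iota>" "additive \<kappa>" by (simp_all add: \<iota>_def \<kappa>_def)
  have a: "(\<sigma>, a \<sigma>) \<in> gens i s" if "(\<sigma>, j) \<in> gens i s" for \<sigma> j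
    unfolding a_def using that by (rule someI)
  have "p1 (\<kappa> u) = u + \<iota> (augmentation u)"
  proof (rule additive_eq_on_keys_span[OF assms(1)])
    fix b assume b: "b \<in> gens i s"
    obtain \<sigma> j where j: "b = (\<sigma>, j)" by (cases b)
    show "p1 (\<kappa> (basis_elem b)) = basis_elem b + \<iota> (augmentation (basis_elem b))"
      using b a[of \<sigma> j] unfolding j
      by (simp add: \<kappa>_def \<iota>_def p1_connecting_path gens_def)
  qed (use add in \<open>simp_all add: additive_def add_ac\<close>)
  moreover have "\<kappa> u \<in> R i s"
    unfolding \<kappa>_def using assms(1)
    by (rule lin_ext_in_keys_span) (use a in \<open>auto intro!: connecting_path_in\<close>)
  ultimately show thesis
    using that assms(2) additive.zero[OF add(1)] by simp
qed

lemma p2_onto_kernel: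
  assumes "v \<in> R i s" "p1 v = 0" shows "p2 (fill v) = v"
  using p2_fill[OF assms(1)] assms(2) by simp

text \<open>Lifted to generators, this is the fact that \<open>f0\<close> lands among live
  generators.\<close>

lemma simplicial_boundary_in:
  assumes "c \<in> C i s" shows "simplicial_boundary c \<in> C (i - 1) s"
  by (rule augmentation_onto[OF assms]) (auto simp flip: augmentation_f0[of y] intro!: augmentation_in f0_in)

text \<open>On a lift to generators, \<open>f0\<close> applied twice is \<open>p1\<close> after
  \<open>h0\<close>, which the augmentation kills.\<close>

lemma simplicial_boundary_boundary:
  assumes "c \<in> C i s" shows "simplicial_boundary (simplicial_boundary c) = 0"
  by (rule augmentation_onto[OF assms]) (auto simp flip: augmentation_f0[of y] p1_h0)

text \<open>The third component is \<open>H\<^sup>0 u + h\<^sup>1 v + f\<^sup>2 w\<close>, written as the \<open>p\<^sup>2\<close>-preimage that makes the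
  second component of \<open>bd \<circ> bd\<close> vanish.\<close>

definition bd where
  "bd = (\<lambda>(u, v, w). let u' = f0 y u + p1 v; v' = h0 F y u + f1 F y v + p2 w
     in (u', v', fill (h0 F y u' + f1 F y v')))"

abbreviation "X i s \<equiv> G i s \<times> R (i - 1) s \<times> S (i - 2) s"

lemma additive_bd [simp]: "additive bd"
  by (auto simp: additive_def bd_def Let_def add_ac)

lemma bd_in:
  assumes "x \<in> X i s" shows "bd x \<in> X (i - 1) s"
proof -
  obtain u v w where x: "x = (u, v, w)" by (cases x)
  then have uvw: "u \<in> G i s" "v \<in> R (i - 1) s" "w \<in> S (i - 2) s"
    using assms by auto
  have 1: "f0 y u + p1 v \<in> G (i - 1) s"
    using f0_in[OF uvw(1)] p1_in[OF uvw(2)] by auto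
  have 2: "h0 F y u + f1 F y v + p2 w \<in> R (i - 2) s"
    using h0_in[OF uvw(1)] f1_in[OF uvw(2)] p2_in[OF uvw(3)] by auto
  have "fill (h0 F y (f0 y u + p1 v) + f1 F y (h0 F y u + f1 F y v + p2 w)) \<in> S (i - 3) s"
    using h0_in[OF 1] f1_in[OF 2] by (intro fill_in keys_span_add) simp_all
  with 1 2 show ?thesis
    by (simp add: x bd_def Let_def)
qed

text \<open>The contributions of \<open>u\<close> and of \<open>v\<close> each occur twice, and that
  of \<open>w\<close> is killed by \<open>p1 (p2 w) = 0\<close>. Besides giving the first component
  of the squared boundary, the equation places the argument of the next \<open>fill\<close> in the
  kernel of \<open>p1\<close>.\<close>

lemma bd_components_cycle:
  assumes "(u, v, w) \<in> X i s"
  shows "f0 y (f0 y u + p1 v) + p1 (h0 F y u + f1 F y v + p2 w) = 0"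
  using p1_h0[of u i s] p1_f1[of v "i - 1" s] assms by (simp add: add_ac)

lemma bd_bd:
  assumes "x \<in> X i s" shows "bd (bd x) = 0"
proof -
  obtain u v w where x: "x = (u, v, w)" by (cases x)
  define u' v' where "u' = f0 y u + p1 v" and "v' = h0 F y u + f1 F y v + p2 w"
  have in': "u' \<in> G (i - 1) s" "v' \<in> R (i - 2) s"
    using bd_in[OF assms] by (simp_all add: x bd_def Let_def u'_def v'_def)
  have eq: "f0 y u' + p1 v' = 0"
    unfolding u'_def v'_def using assms x bd_components_cycle by blast
  have "h0 F y u' + f1 F y v' \<in> R (i - 3) s"
    using h0_in[OF in'(1)] f1_in[OF in'(2)] by simp
  moreover have "p1 (h0 F y u' + f1 F y v') = f0 y (f0 y u' + p1 v')"
    using p1_h0[OF in'(1)] p1_f1[OF in'(2)] by simp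
  ultimately have "p2 (fill (h0 F y u' + f1 F y v')) = h0 F y u' + f1 F y v'"
    by (intro p2_onto_kernel) (simp_all only: eq linear_maps_zero)
  then have "h0 F y u' + f1 F y v' + p2 (fill (h0 F y u' + f1 F y v')) = 0"
    by (simp only: bit_poly_add_self)
  moreover have "bd x = (u', v', fill (h0 F y u' + f1 F y v'))"
    by (simp only: x bd_def Let_def prod.case u'_def v'_def)
  ultimately show ?thesis
    by (simp only: bd_def Let_def prod.case eq linear_maps_zero add_0_right zero_prod_def)
qed

lemma augmentation_fst_bd: "augmentation (fst (bd x)) = simplicial_boundary (augmentation (fst x))"
  by (cases x) (simp add: bd_def Let_def augmentation_f0)

text \<open>After lifting \<open>c\<close> to \<open>u\<close>, the entry \<open>v\<close> is chosen
  to cancel the first component of the boundary and \<open>w\<close> the second. The third has then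
  become \<open>fill 0\<close>.\<close>

lemma augmentation_onto_cycles:
  assumes "c \<in> C i s" "simplicial_boundary c = 0"
  shows "\<exists>x\<in>X i s. bd x = 0 \<and> augmentation (fst x) = c"
proof -
  obtain u where u: "u \<in> G i s" "augmentation u = c"
    using augmentation_onto[OF assms(1)] .
  have "augmentation (f0 y u) = 0"
    using u assms(2) by (simp add: augmentation_f0)
  then obtain v where v: "v \<in> R (i - 1) s" "p1 v = f0 y u"
    using augmentation_exact[OF f0_in[OF u(1)]] by blast
  define w where "w = fill (h0 F y u + f1 F y v)"
  have "h0 F y u + f1 F y v \<in> R (i - 2) s"
    using h0_in[OF u(1)] f1_in[OF v(1)] by simp
  moreover have "p1 (h0 F y u + f1 F y v) = 0"
    using p1_h0[OF u(1)] p1_f1[OF v(1)] v(2) by simp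
  ultimately have "w \<in> S (i - 2) s" "p2 w = h0 F y u + f1 F y v"
    unfolding w_def by (auto intro: fill_in p2_onto_kernel simp del: linear_maps_add)
  with u v show ?thesis
    by (intro bexI[of _ "(u, v, w)"]) (simp_all add: bd_def zero_prod_def)
qed

text \<open>A lift \<open>u'\<close> of \<open>c\<close> is corrected by \<open>v'\<close> and
  \<open>w'\<close> so that the first two components agree with \<open>x\<close>. No freedom is left
  for the third, but the remaining error is a cycle concentrated in the syzygies, hence zero by
  injectivity of \<open>p2\<close>.\<close>

lemma augmentation_reflects_boundaries:
  assumes "x \<in> X i s" "bd x = 0" "c \<in> C (i + 1) s" "augmentation (fst x) = simplicial_boundary c"
  shows "\<exists>x'\<in>X (i + 1) s. bd x' = x"
proof -
  obtain u v w where x: "x = (u, v, w)" by (cases x)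
  have uvw: "u \<in> G i s" "v \<in> R (i - 1) s" "w \<in> S (i - 2) s"
    and cyc: "f0 y u + p1 v = 0"
    using assms(1,2) by (auto simp: x bd_def Let_def zero_prod_def)
  obtain u' where u': "u' \<in> G (i + 1) s" "augmentation u' = c"
    using augmentation_onto[OF assms(3)] .
  have f0u': "f0 y u' \<in> G i s" and h0u': "h0 F y u' \<in> R (i - 1) s"
    using f0_in[OF u'(1)] h0_in[OF u'(1)] by simp_all
  have "augmentation (u + f0 y u') = 0"
    using u'(2) assms(4) by (simp add: x augmentation_f0)
  then obtain v' where v': "v' \<in> R i s" "p1 v' = u + f0 y u'"
    using augmentation_exact[of "u + f0 y u'" i s] uvw f0u' by blast
  define w' where "w' = fill (v + h0 F y u' + f1 F y v')"
  have "v + h0 F y u' + f1 F y v' \<in> R (i - 1) s"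
    using uvw h0u' f1_in[OF v'(1)] by simp
  \<comment> \<open>The terms \<open>f0 y (f0 y u')\<close> cancel, leaving
    \<open>p1 v + f0 y u\<close>, the first component of \<open>bd x\<close>.\<close>
  moreover have "p1 (v + h0 F y u' + f1 F y v') = 0"
    using p1_h0[OF u'(1)] p1_f1[OF v'(1)] v'(2) cyc by (simp add: add_ac)
  ultimately have w': "w' \<in> S (i - 1) s" "p2 w' = v + h0 F y u' + f1 F y v'"
    unfolding w'_def by (auto intro: fill_in p2_onto_kernel simp del: linear_maps_add)
  let ?x' = "(u', v', w')"
  have x'_in: "?x' \<in> X (i + 1) s"
    using u' v' w' by simp
  define w'' where "w'' = w + snd (snd (bd ?x'))"
  have bdx': "x + bd ?x' = (0, 0, w'')"
    using v'(2) w'(2) by (simp add: x w''_def bd_def Let_def add_ac)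
  have w''_in: "w'' \<in> S (i - 2) s"
    using uvw(3) bd_in[OF x'_in] unfolding w''_def
    by (intro keys_span_add) (auto simp: algebra_simps)
  have "bd (0, 0, w'') = 0"
    unfolding bdx'[symmetric] using assms(2) bd_bd[OF x'_in] by (simp add: additive.add)
  then have "p2 w'' = 0"
    by (simp add: bd_def Let_def zero_prod_def)
  then have "w'' = 0"
    using fill_p2[OF w''_in] by simp
  then have "bd ?x' = x"
    using bdx' by (cases "bd ?x'") (simp add: x bit_poly_add_eq_0_iff)
  with x'_in show ?thesis by blast
qed

end

section \<open>The free resolution\<close>

text \<open>\<open>free_bimodule\<close> asks for a basis inside the type of the vectors, so the
  three bases are embedded as triples with two zero entries. Basis elements are nonzero, so the
  three images are disjoint and \<open>gr\<close> can read the grade off the triple.\<close>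

lemma free_bimodule_sum3:
  fixes B1 :: "'a set" and B2 :: "'b set" and B3 :: "'c set"
  shows "free_bimodule (free_on B1 g1 \<oplus>\<^sub>m free_on B2 g2 \<oplus>\<^sub>m free_on B3 g3)"
    (is "free_bimodule ?M")
proof -
  let ?e1 = "\<lambda>b :: 'a. (basis_elem b, 0 :: 'b \<Rightarrow>\<^sub>0 bit, 0 :: 'c \<Rightarrow>\<^sub>0 bit)"
  let ?e2 = "\<lambda>b :: 'b. (0 :: 'a \<Rightarrow>\<^sub>0 bit, basis_elem b, 0 :: 'c \<Rightarrow>\<^sub>0 bit)"
  let ?e3 = "\<lambda>b :: 'c. (0 :: 'a \<Rightarrow>\<^sub>0 bit, 0 :: 'b \<Rightarrow>\<^sub>0 bit, basis_elem b)"
  define B where "B = ?e1 ` B1 \<union> ?e2 ` B2 \<union> ?e3 ` B3"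
  define gr where "gr e = (if e \<in> ?e1 ` B1 then g1 (THE b. e = ?e1 b) else
    if e \<in> ?e2 ` B2 then g2 (THE b. e = ?e2 b) else g3 (THE b. e = ?e3 b))" for e
  \<comment> \<open>The keys are themselves vectors of the sum, so \<open>\<phi>\<close> just adds
    up the keys, componentwise.\<close>
  define \<phi> where "\<phi> v = (lin_ext fst v, lin_ext (fst \<circ> snd) v, lin_ext (snd \<circ> snd) v)"
    for v :: "(('a \<Rightarrow>\<^sub>0 bit) \<times> ('b \<Rightarrow>\<^sub>0 bit) \<times> ('c \<Rightarrow>\<^sub>0 bit)) \<Rightarrow>\<^sub>0 bit"
  define \<psi> where "\<psi> = (\<lambda>(u, v, w). lin_ext (basis_elem \<circ> ?e1) u + lin_ext (basis_elem \<circ> ?e2) v + lin_ext (basis_elem \<circ> ?e3) w)"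
  have inj: "basis_elem b = basis_elem b' \<longleftrightarrow> b = b'" for b b' :: 'd
    by (metis keys_basis_elem singleton_inject)
  have nz: "basis_elem b \<noteq> 0" "0 \<noteq> basis_elem b" for b :: 'd
    by (metis keys_basis_elem insert_not_empty keys_zero)+
  have gr: "b \<in> B1 \<Longrightarrow> gr (?e1 b) = g1 b" "b' \<in> B2 \<Longrightarrow> gr (?e2 b') = g2 b'"
    "b'' \<in> B3 \<Longrightarrow> gr (?e3 b'') = g3 b''" for b b' b''
    by (auto simp: gr_def inj nz)
  let ?L = "\<lambda>B g. live_at B (\<lambda>b. {g b})"
  have live: "?L B gr s = ?e1 ` ?L B1 g1 s \<union> ?e2 ` ?L B2 g2 s \<union> ?e3 ` ?L B3 g3 s" for s
    unfolding live_at_def B_def using gr by fastforce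
  have car: "carrier (at_grade ?M s) = keys_span (?L B1 g1 s) \<times> keys_span (?L B2 g2 s) \<times> keys_span (?L B3 g3 s)" for s
    by (simp add: bimodule_sum_def free_on_def)
  have bip: "bipersistence_module (free_on B g)" for B g
    unfolding free_on_def by (rule bipersistence_module_upset_sum)
  have M: "bipersistence_module ?M"
    by (intro bipersistence_module_bimodule_sum bip)
  have \<phi>_add: "\<phi> (u + v) = \<phi> u + \<phi> v" for u v
    by (simp add: \<phi>_def)
  have \<psi>_add: "\<psi> (u + v) = \<psi> u + \<psi> v" for u v
    by (cases u; cases v) (simp add: \<psi>_def add_ac)
  have \<phi>_in: "\<phi> v \<in> carrier (at_grade ?M s)" if "v \<in> keys_span (?L B gr s)" for v s
    unfolding car \<phi>_def using that
    by (auto intro!: lin_ext_in_keys_span[OF that] simp: live)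
  have \<psi>_in: "\<psi> x \<in> keys_span (?L B gr s)" if "x \<in> carrier (at_grade ?M s)" for x s
    using that unfolding car \<psi>_def
    by (auto intro!: keys_span_add elim!: lin_ext_in_keys_span simp: live)
  \<comment> \<open>The restriction on keys matters: \<open>\<psi>\<close> would split a key with
    several nonzero entries into embedded basis triples.\<close>
  have \<psi>\<phi>: "\<psi> (\<phi> v) = v" if "v \<in> keys_span (?L B gr s)" for v s
  proof (rule additive_eq_on_keys_span[OF that])
    show "\<psi> (\<phi> (basis_elem b)) = basis_elem b" if "b \<in> ?L B gr s" for b
      using that by (auto simp: live \<phi>_def \<psi>_def)
  qed (simp_all add: additive_def \<phi>_add \<psi>_add)
  have \<phi>\<psi>: "\<phi> (\<psi> x) = x" for x
  proof -
    have 1: "\<phi> (lin_ext (basis_elem \<circ> ?e1) u) = (u, 0, 0)" for u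
      by (rule additive_eq_on_keys_span[of u UNIV]) (simp_all add: additive_def \<phi>_add, simp add: \<phi>_def)
    have 2: "\<phi> (lin_ext (basis_elem \<circ> ?e2) u) = (0, u, 0)" for u
      by (rule additive_eq_on_keys_span[of u UNIV]) (simp_all add: additive_def \<phi>_add, simp add: \<phi>_def)
    have 3: "\<phi> (lin_ext (basis_elem \<circ> ?e3) u) = (0, 0, u)" for u
      by (rule additive_eq_on_keys_span[of u UNIV]) (simp_all add: additive_def \<phi>_add, simp add: \<phi>_def)
    show ?thesis
      by (cases x) (simp add: \<psi>_def \<phi>_add 1 2 3)
  qed
  have "linear_map (at_grade (free_on B gr) s) (at_grade ?M s) \<phi>" for s
  proof (rule linear_mapI[OF bipersistence_moduleD(1)[OF bip] bipersistence_moduleD(1)[OF M]])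
    show "\<phi> x \<in> carrier (at_grade ?M s)" if "x \<in> carrier (at_grade (free_on B gr) s)" for x
      using that \<phi>_in by (simp add: free_on_def)
    show "\<phi> (x \<oplus>\<^bsub>at_grade (free_on B gr) s\<^esub> x') = \<phi> x \<oplus>\<^bsub>at_grade ?M s\<^esub> \<phi> x'" for x x'
      by (simp add: free_on_def bimodule_sum_def \<phi>_def)
  qed
  moreover have "shift ?M s t x = x" for s t x
    by (cases x) (simp add: bimodule_sum_def free_on_def)
  ultimately have "bimodule_hom (free_on B gr) ?M (\<lambda>s. \<phi>)"
    by (simp add: bimodule_hom_def) (simp add: free_on_def)
  moreover have "bij_betw \<phi> (carrier (at_grade (free_on B gr) s)) (carrier (at_grade ?M s))" for s
  proof -
    have "carrier (at_grade (free_on B gr) s) = keys_span (?L B gr s)"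
      by (simp add: free_on_def)
    then show ?thesis
      by (intro bij_betw_byWitness[of _ \<psi>] ballI image_subsetI)
         (simp_all only: \<phi>\<psi> \<psi>\<phi>[of _ s] \<phi>_in \<psi>_in)
  qed
  ultimately show ?thesis
    using M unfolding free_bimodule_def bimodule_iso_def by blast
qed

context log_path
begin

section \<open>Carriers of the log-path modules\<close>

lemma live_at_gens:
  "live_at (SIGMA \<sigma>:simplices K i. {0..last_index F \<sigma>}) (\<lambda>b. {(\<lambda>(\<sigma>, j). min_grade F \<sigma> j) b}) s = gens i s"
  by (auto simp: live_at_def gens_def)

lemma live_at_rels:
  "live_at (SIGMA \<sigma>:simplices K i. dyadic_edges (last_index F \<sigma>))
     (\<lambda>b. {(\<lambda>(\<sigma>, (j, l)). sup (min_grade F \<sigma> j) (min_grade F \<sigma> l)) b}) s = rels i s"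
  by (auto simp: live_at_def rels_def)

lemma live_at_syzs:
  "live_at (SIGMA \<sigma>:simplices K i. dyadic_triangles (last_index F \<sigma>))
     (\<lambda>b. {(\<lambda>(\<sigma>, (j, k, l)). sup (min_grade F \<sigma> j) (min_grade F \<sigma> l)) b}) s = syzs i s"
  by (auto simp: live_at_def syzs_def)

lemma carrier_Gmod [simp]: "carrier (at_grade (Gmod K F i) s) = G i s"
  and carrier_Rmod [simp]: "carrier (at_grade (Rmod K F i) s) = R i s"
  and carrier_Smod [simp]: "carrier (at_grade (Smod K F i) s) = S i s"
  by (simp_all only: Gmod_def Rmod_def Smod_def free_on_def carrier_upset_sum live_at_gens live_at_rels live_at_syzs)

lemma mod_simps [simp]:
  "zero (at_grade (Gmod K F i) s) = 0" "add (at_grade (Gmod K F i) s) = (+)" "shift (Gmod K F i) s t = (\<lambda>v. v)"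
  "zero (at_grade (Rmod K F i) s) = 0" "add (at_grade (Rmod K F i) s) = (+)" "shift (Rmod K F i) s t = (\<lambda>v. v)"
  "zero (at_grade (Smod K F i) s) = 0" "add (at_grade (Smod K F i) s) = (+)" "shift (Smod K F i) s t = (\<lambda>v. v)"
  by (simp_all only: Gmod_def Rmod_def Smod_def free_on_def carrier_upset_sum)

lemma bipersistence_mods: "bipersistence_module (Gmod K F i)" "bipersistence_module (Rmod K F i)"
    "bipersistence_module (Smod K F i)"
  unfolding Gmod_def Rmod_def Smod_def free_on_def by (rule bipersistence_module_upset_sum)+

text \<open>Composing \<open>fill\<close> with \<open>\<psi>\<close> shows that a lift exists. Every
  lift agrees with it on carriers because \<open>fill\<close> undoes \<open>p2\<close> there, so the
  value picked by \<open>SOME\<close> is determined at \<open>v\<close>.\<close>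

lemma some_lift_eq:
  fixes \<psi> :: "('b \<Rightarrow>\<^sub>0 bit) \<Rightarrow> ('a rel \<Rightarrow>\<^sub>0 bit)"
  assumes "additive \<psi>" and M: "M = upset_sum B A"
    and \<psi>: "\<And>s v. v \<in> carrier (at_grade M s) \<Longrightarrow> \<psi> v \<in> R i s \<and> p1 (\<psi> v) = 0"
    and v: "v \<in> carrier (at_grade M s)"
  shows "(SOME \<phi>. bimodule_hom M (Smod K F i) \<phi> \<and>
    (\<forall>s. \<forall>v\<in>carrier (at_grade M s). p2 (\<phi> s v) = \<psi> v)) s v = fill (\<psi> v)"
    (is "(SOME \<phi>. ?P \<phi>) s v = _")
proof -
  have "bimodule_hom M (Smod K F i) (\<lambda>s v. fill (\<psi> v))"
    unfolding Smod_def free_on_def M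
  proof (rule bimodule_hom_additive)
    show "additive (\<lambda>v. fill (\<psi> v))"
      using assms(1) by (simp add: additive_def)
    show "fill (\<psi> v) \<in> keys_span (live_at (SIGMA \<sigma>:simplices K i. dyadic_triangles (last_index F \<sigma>))
        (\<lambda>b. {case b of (\<sigma>, j, k, l) \<Rightarrow> sup (min_grade F \<sigma> j) (min_grade F \<sigma> l)}) s)"
      if "v \<in> keys_span (live_at B A s)" for s v
      unfolding live_at_syzs using \<psi>[of v s] that by (simp add: M fill_in)
  qed
  then have "?P (\<lambda>s v. fill (\<psi> v))"
    using \<psi> p2_onto_kernel by blast
  then have P: "?P (SOME \<phi>. ?P \<phi>)"
    by (rule someI[of ?P])
  let ?\<phi> = "SOME \<phi>. ?P \<phi>"
  have "linear_map (at_grade M s) (at_grade (Smod K F i) s) (?\<phi> s)"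
    using P unfolding bimodule_hom_def by blast
  then have "?\<phi> s v \<in> S i s"
    using v by (auto simp: linear_map_def)
  then have "fill (p2 (?\<phi> s v)) = ?\<phi> s v"
    by (rule fill_p2)
  moreover have "p2 (?\<phi> s v) = \<psi> v"
    using P v by blast
  ultimately show ?thesis by simp
qed

text \<open>Each of the three lifts exists because \<open>p1\<close> kills its right-hand side. For
  \<open>f2\<close> this reduces to \<open>p1 (p2 w) = 0\<close>; for \<open>h1\<close> both terms
  become \<open>f0 y (f0 y (p1 v))\<close>, and for \<open>H0\<close> both become
  \<open>f0 y (f0 y (f0 y u))\<close>.\<close>

lemma f2_eq:
  assumes "w \<in> S i s" shows "f2 K F y i s w = fill (f1 F y (p2 w))"
  unfolding f2_def
proof (rule some_lift_eq)
  show "Smod K F i = upset_sum (SIGMA \<sigma>:simplices K i. dyadic_triangles (last_index F \<sigma>))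
      (\<lambda>b. {case b of (\<sigma>, j, k, l) \<Rightarrow> sup (min_grade F \<sigma> j) (min_grade F \<sigma> l)})"
    by (simp add: Smod_def free_on_def)
  show "f1 F y (p2 v) \<in> R (i - 1) s \<and> p1 (f1 F y (p2 v)) = 0"
    if "v \<in> carrier (at_grade (Smod K F i) s)" for s v
    using p2_in[of v i s] f1_in p1_f1 that by simp
qed (use assms in \<open>simp_all add: additive_def\<close>)

lemma h1_eq:
  assumes "v \<in> R i s" shows "h1 K F y i s v = fill (h0 F y (p1 v) + f1 F y (f1 F y v))"
  unfolding h1_def
proof (rule some_lift_eq)
  show "Rmod K F i = upset_sum (SIGMA \<sigma>:simplices K i. dyadic_edges (last_index F \<sigma>))
      (\<lambda>b. {case b of (\<sigma>, j, l) \<Rightarrow> sup (min_grade F \<sigma> j) (min_grade F \<sigma> l)})"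
    by (simp add: Rmod_def free_on_def)
  show "h0 F y (p1 v) + f1 F y (f1 F y v) \<in> R (i - 2) s \<and> p1 (h0 F y (p1 v) + f1 F y (f1 F y v)) = 0"
    if "v \<in> carrier (at_grade (Rmod K F i) s)" for s v
  proof -
    have v: "v \<in> R i s" using that by simp
    show ?thesis
      using h0_in[OF p1_in[OF v]] f1_in[OF f1_in[OF v]] p1_h0[OF p1_in[OF v]] p1_f1[OF f1_in[OF v]] p1_f1[OF v]
      by simp
  qed
qed (use assms in \<open>simp_all add: additive_def add_ac\<close>)

lemma H0_eq:
  assumes "u \<in> G i s" shows "H0 K F y i s u = fill (h0 F y (f0 y u) + f1 F y (h0 F y u))"
  unfolding H0_def
proof (rule some_lift_eq)
  show "Gmod K F i = upset_sum (SIGMA \<sigma>:simplices K i. {0..last_index F \<sigma>})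
      (\<lambda>b. {case b of (\<sigma>, j) \<Rightarrow> min_grade F \<sigma> j})"
    by (simp add: Gmod_def free_on_def)
  show "h0 F y (f0 y u) + f1 F y (h0 F y u) \<in> R (i - 3) s \<and> p1 (h0 F y (f0 y u) + f1 F y (h0 F y u)) = 0"
    if "u \<in> carrier (at_grade (Gmod K F i) s)" for s u
  proof -
    have u: "u \<in> G i s" using that by simp
    show ?thesis
      using h0_in[OF f0_in[OF u]] f1_in[OF h0_in[OF u]] p1_h0[OF f0_in[OF u]] p1_f1[OF h0_in[OF u]] p1_h0[OF u]
      by simp
  qed
qed (use assms in \<open>simp_all add: additive_def add_ac\<close>)

section \<open>Assembly of the resolution\<close>

abbreviation "LP \<equiv> log_path_complex K F y"
abbreviation "SC \<equiv> simplicial_chains K F"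

lemma LP_simps [simp]:
  "carrier (chains_at LP i s) = X i s" "zero (chains_at LP i s) = 0" "add (chains_at LP i s) = (+)"
  "shift (chains LP i) s t = (\<lambda>x. x)"
  by (simp_all add: log_path_complex_def bimodule_sum_def fun_eq_iff zero_prod_def)

lemma SC_simps [simp]:
  "carrier (chains_at SC i s) = C i s" "zero (chains_at SC i s) = 0" "add (chains_at SC i s) = (+)"
  "shift (chains SC i) s t = (\<lambda>x. x)" "bdry SC i s = simplicial_boundary"
  by (simp_all add: simplicial_chains_def simplicial_boundary_def)

text \<open>Outside the carriers the chosen lifts are arbitrary, so the passage to \<open>bd\<close>
  is conditional and later arguments keep membership in \<open>X i s\<close> explicit.\<close>

lemma bdry_LP [simp]:
  assumes "x \<in> X i s" shows "bdry LP i s x = bd x"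
  using assms
  by (auto simp: log_path_complex_def bd_def Let_def H0_eq h1_eq f2_eq add_ac)

lemma chain_complex_LP: "chain_complex LP"
proof -
  have bip: "bipersistence_module (chains LP i)" for i
    unfolding log_path_complex_def bicomplex.simps
    by (intro bipersistence_module_bimodule_sum bipersistence_mods)
  note mod = bipersistence_moduleD(1)[OF bip]
  have "linear_map (chains_at LP i s) (chains_at LP (i - 1) s) (bdry LP i s)" for i s
  proof (rule linear_mapI[OF mod mod])
    fix x x' assume x: "x \<in> carrier (chains_at LP i s)"
    then show "bdry LP i s x \<in> carrier (chains_at LP (i - 1) s)"
      using bd_in[of x i s] by (simp only: LP_simps bdry_LP)
    assume x': "x' \<in> carrier (chains_at LP i s)"
    then have "x + x' \<in> X i s"
      using x by auto
    then show "bdry LP i s (x \<oplus>\<^bsub>chains_at LP i s\<^esub> x') = bdry LP i s x \<oplus>\<^bsub>chains_at LP (i - 1) s\<^esub> bdry LP i s x'"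
      using x x' by (simp only: LP_simps bdry_LP additive.add[OF additive_bd])
  qed
  \<comment> \<open>The structure maps are identities, so the fact that they are linear maps
    contains the inclusion of carriers.\<close>
  moreover have "x \<in> X i t" if "s \<le> t" "x \<in> X i s" for s t i x
    using bipersistence_moduleD(2)[OF bip that(1), of i] that(2) by (auto simp: linear_map_def)
  ultimately have "bimodule_hom (chains LP i) (chains LP (i - 1)) (bdry LP i)" for i
    unfolding bimodule_hom_def LP_simps by (metis bdry_LP)
  moreover have "bdry LP (i - 1) s (bdry LP i s x) = \<zero>\<^bsub>chains_at LP (i - 2) s\<^esub>"
    if "x \<in> carrier (chains_at LP i s)" for i s x
  proof -
    have x: "x \<in> X i s" using that by (simp only: LP_simps)
    show ?thesis
      by (simp only: LP_simps bdry_LP[OF x] bdry_LP[OF bd_in[OF x]] bd_bd[OF x])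
  qed
  ultimately show ?thesis
    using bip unfolding chain_complex_def by blast
qed

lemma chain_complex_SC: "chain_complex SC"
proof -
  have "bimodule_hom (chains SC i) (chains SC (i - 1)) (bdry SC i)" for i
    unfolding simplicial_chains_def bicomplex.simps simplicial_boundary_def[symmetric]
    by (rule bimodule_hom_additive) (simp_all add: simplicial_boundary_in)
  moreover have "bipersistence_module (chains SC i)" for i
    by (simp add: simplicial_chains_def bipersistence_module_upset_sum)
  ultimately show ?thesis
    unfolding chain_complex_def by (simp add: simplicial_boundary_boundary)
qed

lemma chain_map_augmentation: "chain_map LP SC (\<lambda>i s x. augmentation (fst x))"
proof -
  have in_C: "augmentation (fst x) \<in> C i s" if "x \<in> X i s" for x i s
    using that by (auto intro: augmentation_in)
  have "linear_map (chains_at LP i s) (chains_at SC i s) (\<lambda>x. augmentation (fst x))" for i s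
    by (rule linear_mapI[OF chain_complexD(1)[OF chain_complex_LP] chain_complexD(1)[OF chain_complex_SC]])
       (simp_all only: LP_simps SC_simps in_C fst_add augmentation_add)
  moreover have "augmentation (fst (bdry LP i s x)) = simplicial_boundary (augmentation (fst x))"
    if "x \<in> X i s" for i s x
    by (simp only: bdry_LP[OF that] augmentation_fst_bd)
  ultimately show ?thesis
    unfolding chain_map_def bimodule_hom_def LP_simps SC_simps by blast
qed

lemma free_resolution_log_path: "free_resolution LP SC"
proof -
  have "bimodule_iso (homology LP i) (homology SC i)
      (homology_map SC (\<lambda>i s x. augmentation (fst x)) i)" for i
  proof (rule bimodule_iso_homology[OF chain_complex_LP chain_complex_SC chain_map_augmentation])
    fix i s c assume "c \<in> cycles SC i s"
    then obtain x where "x \<in> X i s" "bd x = 0" "augmentation (fst x) = c"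
      using augmentation_onto_cycles[of c i s] by (auto simp: cycles_def)
    then show "\<exists>x\<in>cycles LP i s. augmentation (fst x) = c"
      unfolding cycles_def LP_simps by (metis (mono_tags, lifting) bdry_LP mem_Collect_eq)
  next
    fix i s x assume "x \<in> cycles LP i s" and b: "augmentation (fst x) \<in> boundaries SC i s"
    then have x: "x \<in> X i s" "bd x = 0"
      unfolding cycles_def LP_simps by (auto simp del: mem_Times_iff)
    obtain c where "c \<in> C (i + 1) s" "augmentation (fst x) = simplicial_boundary c"
      using b by (auto simp: boundaries_def)
    then obtain x' where "x' \<in> X (i + 1) s" "bd x' = x"
      using augmentation_reflects_boundaries[OF x] by blast
    then show "x \<in> boundaries LP i s"
      unfolding boundaries_def LP_simps by (metis bdry_LP image_eqI)
  qed
  moreover have "free_bimodule (chains LP i)" for i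
    unfolding log_path_complex_def bicomplex.simps Gmod_def Rmod_def Smod_def
    by (rule free_bimodule_sum3)
  ultimately show ?thesis
    unfolding free_resolution_def using chain_complex_LP chain_map_augmentation by blast
qed

end

theorem theorem7:
  fixes K :: "'a set set"
    and F :: "grade \<Rightarrow> 'a set set"
    and y :: "'a set \<Rightarrow> nat \<Rightarrow> 'a set \<Rightarrow> nat"
  assumes "simplicial_bifiltration K F"
    and "facet_choice K F y"
  shows "free_resolution (log_path_complex K F y) (simplicial_chains K F)"
proof -
  interpret log_path K F y
    by standard fact+
  show ?thesis
    by (rule free_resolution_log_path)
qed

end
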